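(* There is a rearrangement invariant Banach space $X$ over the measure space $[0,\infty)$ with Lebesgue measure such that for every Orlicz–Lorentz space $L_{F,G}$ (with $F$ and $G$ $\varphi$-functions), the norms $\|\cdot\|_X$ and $\|\cdot\|_{F,G}$ are inequivalent on the vector space of simple functions; that is, there is no constant $c<\infty$ with $c^{-1}\|f\|_X\le\|f\|_{F,G}\le c\|f\|_X$ for all simple functions $f$.
   Context: A $\varphi$-function is a function $F:[0,\infty)\to[0,\infty)$ that is continuous and strictly increasing with $F(0)=0$ and $\lim_{t\to\infty}F(t)=\infty$. Put $\tilde F(t)=1/F(1/t)$ for $t>0$ and $\tilde F(0)=0$. For a measurable (complex-valued) function $f$ on $[0,\infty)$ with Lebesgue measure $\mu$, $f^*(x)=\sup\{t:\mu(|f|\ge t)\ge x\}$ is the non-increasing rearrangement. The Luxemburg functional is $\|f\|_G=\inf\{c:\int_0^\infty G(|f(x)|/c)\,dx\le1\}$. The Orlicz–Lorentz functional is $\|f\|_{F,G}=\|f^*\circ\tilde F\circ\tilde G^{-1}\|_G$, and $L_{F,G}$ is the space of measurable $f$ with $\|f\|_{F,G}<\infty$, modulo functions zero a.e. Simple functions are finite linear combinations of indicator functions of measurable sets of finite measure. *)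

theory Defs
  imports "HOL-Analysis.Analysis"
begin

text \<open>
  Functions on \<open>[0,\<infinity>)\<close> are total functions on \<^typ>\<open>real\<close> of which only the values on \<open>[0,\<infinity>)\<close>
  matter. Instead of equivalence classes modulo equality almost everywhere we work with
  representatives; all functionals below depend on the class only.
\<close>

abbreviation half_line :: "real measure" where
  "half_line \<equiv> lebesgue_on {0..}"

definition phi_function :: "(real \<Rightarrow> real) \<Rightarrow> bool" where
  "phi_function F \<longleftrightarrow>
     continuous_on {0..} F \<and> strict_mono_on {0..} F \<and> F 0 = 0 \<and> filterlim F at_top at_top"

definition tilde :: "(real \<Rightarrow> real) \<Rightarrow> real \<Rightarrow> real" where
  "tilde F t = (if t > 0 then 1 / F (1 / t) else 0)"

text \<open>
  The rearrangement takes values in \<open>[0,\<infinity>]\<close>: it is \<open>\<infinity>\<close> at \<open>0\<close>, and it can be \<open>\<infinity>\<close> elsewhere if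
  all the sets \<open>{|f| \<ge> t}\<close> have large measure.
\<close>

definition rearrangement :: "(real \<Rightarrow> complex) \<Rightarrow> real \<Rightarrow> ennreal" where
  "rearrangement f x =
     Sup {ennreal t |t. t \<ge> 0 \<and>
            emeasure half_line {y \<in> space half_line. cmod (f y) \<ge> t} \<ge> ennreal x}"

text \<open>The extension of a \<open>\<phi>\<close>-function to \<open>[0,\<infinity>]\<close> by \<open>G(\<infinity>) = \<infinity>\<close>.\<close>

definition extend_top :: "(real \<Rightarrow> real) \<Rightarrow> ennreal \<Rightarrow> ennreal" where
  "extend_top G y = (if y = \<infinity> then \<infinity> else ennreal (G (enn2real y)))"

text \<open>
  The Luxemburg functional is stated for the modulus of a function, with values in \<open>[0,\<infinity>]\<close>, so
  that it applies to rearrangements. The infimum of the empty set is \<open>\<infinity>\<close>.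
\<close>

definition luxemburg :: "(real \<Rightarrow> real) \<Rightarrow> (real \<Rightarrow> ennreal) \<Rightarrow> ennreal" where
  "luxemburg G g =
     Inf {ennreal c |c. c > 0 \<and> (\<integral>\<^sup>+ x. extend_top G (g x / ennreal c) \<partial>half_line) \<le> 1}"

definition orlicz_lorentz :: "(real \<Rightarrow> real) \<Rightarrow> (real \<Rightarrow> real) \<Rightarrow> (real \<Rightarrow> complex) \<Rightarrow> ennreal" where
  "orlicz_lorentz F G f =
     luxemburg G (rearrangement f \<circ> tilde F \<circ> the_inv_into {0..} (tilde G))"

definition simple_fun :: "(real \<Rightarrow> complex) \<Rightarrow> bool" where
  "simple_fun f \<longleftrightarrow>
     (\<exists>(n::nat) (a :: nat \<Rightarrow> complex) (A :: nat \<Rightarrow> real set).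
        (\<forall>i<n. A i \<in> sets half_line \<and> emeasure half_line (A i) < \<infinity>) \<and>
        (\<forall>x\<ge>0. f x = (\<Sum>i<n. a i * indicator (A i) x)))"

definition equimeasurable :: "(real \<Rightarrow> complex) \<Rightarrow> (real \<Rightarrow> complex) \<Rightarrow> bool" where
  "equimeasurable f g \<longleftrightarrow>
     (\<forall>t\<ge>0. emeasure half_line {x \<in> space half_line. cmod (f x) > t}
           = emeasure half_line {x \<in> space half_line. cmod (g x) > t})"

text \<open>
  Rearrangement invariant Banach function spaces over \<open>[0,\<infinity>)\<close> in the sense of Bennett and
  Sharpley, which are the maximal rearrangement invariant spaces of Lindenstrauss and Tzafriri up
  to normalisation of the norm. The space is given by its set \<open>X\<close> of representatives and its norm
  \<open>N\<close>. Completeness would follow from the other axioms, but is part of what is meant by a Banach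
  space. In \<open>fatou\<close>, boundedness of the norms is assumed because \<open>N\<close> has no value outside \<open>X\<close>.
\<close>

locale ri_banach_space =
  fixes X :: "(real \<Rightarrow> complex) set" and N :: "(real \<Rightarrow> complex) \<Rightarrow> real"
  assumes measurable: "f \<in> X \<Longrightarrow> f \<in> borel_measurable half_line"
    and zero: "(\<lambda>x. 0) \<in> X"
    and add: "f \<in> X \<Longrightarrow> g \<in> X \<Longrightarrow> (\<lambda>x. f x + g x) \<in> X"
    and scale: "f \<in> X \<Longrightarrow> (\<lambda>x. a * f x) \<in> X"
    and norm_nonneg: "f \<in> X \<Longrightarrow> N f \<ge> 0"
    and norm_eq_0: "f \<in> X \<Longrightarrow> N f = 0 \<longleftrightarrow> (AE x in half_line. f x = 0)"
    and norm_add: "f \<in> X \<Longrightarrow> g \<in> X \<Longrightarrow> N (\<lambda>x. f x + g x) \<le> N f + N g"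
    and norm_scale: "f \<in> X \<Longrightarrow> N (\<lambda>x. a * f x) = cmod a * N f"
    and complete: "(\<And>n::nat. s n \<in> X) \<Longrightarrow>
          (\<And>e. e > 0 \<Longrightarrow> \<exists>K. \<forall>m\<ge>K. \<forall>n\<ge>K. N (\<lambda>x. s m x - s n x) < e) \<Longrightarrow>
          \<exists>f\<in>X. (\<lambda>n. N (\<lambda>x. s n x - f x)) \<longlonglongrightarrow> 0"
    and ideal: "g \<in> X \<Longrightarrow> f \<in> borel_measurable half_line \<Longrightarrow>
          (AE x in half_line. cmod (f x) \<le> cmod (g x)) \<Longrightarrow> f \<in> X \<and> N f \<le> N g"
    and fatou: "(\<And>n::nat. s n \<in> X) \<Longrightarrow> f \<in> borel_measurable half_line \<Longrightarrow>
          (\<And>n. AE x in half_line. cmod (s n x) \<le> cmod (s (Suc n) x)) \<Longrightarrow>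
          (AE x in half_line. (\<lambda>n. cmod (s n x)) \<longlonglongrightarrow> cmod (f x)) \<Longrightarrow>
          (\<And>n. N (s n) \<le> B) \<Longrightarrow> f \<in> X \<and> (\<lambda>n. N (s n)) \<longlonglongrightarrow> N f"
    and indicator: "A \<in> sets half_line \<Longrightarrow> emeasure half_line A < \<infinity> \<Longrightarrow> indicator A \<in> X"
    and locally_integrable: "A \<in> sets half_line \<Longrightarrow> emeasure half_line A < \<infinity> \<Longrightarrow>
          \<exists>C. \<forall>f\<in>X. (\<integral>\<^sup>+ x\<in>A. ennreal (cmod (f x)) \<partial>half_line) \<le> ennreal (C * N f)"
    and rearrangement_invariant: "f \<in> X \<Longrightarrow> g \<in> borel_measurable half_line \<Longrightarrow>
          equimeasurable f g \<Longrightarrow> g \<in> X \<and> N g = N f"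

end

theory Submission
  imports Defs
begin

text \<open>
  Let \<open>K(a, u)\<close> be the integral of \<open>u*\<close> over \<open>[0, a]\<close>. It equals the infimum over \<open>s \<ge> 0\<close> of \<open>a s\<close> plus the
  integral of \<open>(u - s)\<^sup>+\<close>, which shows its subadditivity. Put \<open>b\<^sub>k = 2 ^ k\<^sup>2\<close>, and split the natural numbers into
  infinitely many infinite blocks. The space \<open>X\<close> has the norm \<open>sup\<^sub>l \<Sum>\<^sub>k K(b\<^sub>k\<^sup>2, |f|) / b\<^sub>k\<close>, where \<open>k\<close> ranges over
  block \<open>l\<close>. Since \<open>b\<close> is very lacunary, the normalised steps \<open>e\<^sub>k\<close>, equal to \<open>1 / b\<^sub>k\<close> on \<open>[0, b\<^sub>k\<^sup>2]\<close>, behave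
  like the basis of \<open>l\<^sub>1\<close> inside a block and like that of \<open>c\<^sub>0\<close> across blocks.

  Suppose that the norm of \<open>L\<^bsub>F,G\<^esub>\<close> is equivalent to it. A sum of \<open>n\<close> steps \<open>e\<^sub>k / n\<close> of one block has norm at least
  \<open>1\<close>, so its modular at a suitable constant exceeds \<open>1\<close>, and one of its steps contributes more than \<open>1 / n\<close>.
  Take such a step from each of \<open>2 n\<close> blocks. As a block has steps on arbitrarily long intervals, these can be
  chosen so sparse that at least half of each contribution survives in the modular of their sum. This modular
  exceeds \<open>1\<close>, whereas the norm of the sum is at most \<open>5 / n\<close>, which is impossible for large \<open>n\<close>.
\<close>

section \<open>The K-functional of the couple of L1 and L-infinity\<close>

definition K_functional :: "'a measure \<Rightarrow> real \<Rightarrow> ('a \<Rightarrow> ennreal) \<Rightarrow> ennreal" where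
  "K_functional M a u = (INF s\<in>{0..}. ennreal (a * s) + (\<integral>\<^sup>+ x. u x - ennreal s \<partial>M))"

lemma K_functional_le:
  "s \<ge> 0 \<Longrightarrow> K_functional M a u \<le> ennreal (a * s) + (\<integral>\<^sup>+ x. u x - ennreal s \<partial>M)"
  unfolding K_functional_def by (rule INF_lower) simp

lemma le_K_functional:
  "(\<And>s. s \<ge> 0 \<Longrightarrow> B \<le> ennreal (a * s) + (\<integral>\<^sup>+ x. u x - ennreal s \<partial>M)) \<Longrightarrow>
    B \<le> K_functional M a u"
  unfolding K_functional_def by (rule INF_greatest) simp

lemma le_cmult_INF_ennreal:
  fixes c :: real and B :: ennreal
  assumes c: "c > 0" and le: "\<And>s. s \<in> S \<Longrightarrow> B \<le> ennreal c * f s"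
  shows "B \<le> ennreal c * (INF s\<in>S. f s)"
proof -
  have "B / ennreal c \<le> (INF s\<in>S. f s)"
    using c le by (intro INF_greatest divide_le_posI_ennreal) auto
  then have "ennreal c * (B / ennreal c) \<le> ennreal c * (INF s\<in>S. f s)"
    by (rule mult_left_mono) simp
  moreover have "ennreal c * (B / ennreal c) = B"
    using c by (metis ennreal_mult_divide_eq ennreal_neq_top ennreal_times_divide less_irrefl
        ennreal_eq_0_iff not_le mult.commute)
  ultimately show ?thesis by simp
qed

lemma K_functional_mono:
  assumes "AE x in M. u x \<le> v x"
  shows "K_functional M a u \<le> K_functional M a v"
proof (rule le_K_functional)
  fix s :: real assume "s \<ge> 0"
  then have "K_functional M a u \<le> ennreal (a * s) + (\<integral>\<^sup>+ x. u x - ennreal s \<partial>M)"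
    by (rule K_functional_le)
  also have "\<dots> \<le> ennreal (a * s) + (\<integral>\<^sup>+ x. v x - ennreal s \<partial>M)"
    using assms by (intro add_left_mono nn_integral_mono_AE) (auto elim!: eventually_mono intro: ennreal_minus_mono)
  finally show "K_functional M a u \<le> \<dots>" .
qed

lemma K_functional_add:
  assumes [measurable]: "u \<in> borel_measurable M" "v \<in> borel_measurable M" and a: "a \<ge> 0"
  shows "K_functional M a (\<lambda>x. u x + v x) \<le> K_functional M a u + K_functional M a v"
proof -
  let ?h = "\<lambda>u s. ennreal (a * s) + (\<integral>\<^sup>+ x. u x - ennreal s \<partial>M)"
  have *: "K_functional M a (\<lambda>x. u x + v x) \<le> ?h u s + ?h v t" if "s \<ge> 0" "t \<ge> 0" for s t
  proof -
    have "K_functional M a (\<lambda>x. u x + v x)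
        \<le> ennreal (a * (s + t)) + (\<integral>\<^sup>+ x. u x + v x - ennreal (s + t) \<partial>M)"
      using that by (intro K_functional_le) simp
    also have "\<dots> \<le> ennreal (a * s) + ennreal (a * t) +
        (\<integral>\<^sup>+ x. (u x - ennreal s) + (v x - ennreal t) \<partial>M)"
    proof (intro add_mono nn_integral_mono)
      show "ennreal (a * (s + t)) \<le> ennreal (a * s) + ennreal (a * t)"
        using that a by (simp add: distrib_left flip: ennreal_plus)
      fix x
      have "u x + v x \<le> (ennreal s + (u x - ennreal s)) + (ennreal t + (v x - ennreal t))"
        by (intro add_mono) (auto simp: add_diff_self_ennreal)
      then show "u x + v x - ennreal (s + t) \<le> (u x - ennreal s) + (v x - ennreal t)"
        using that by (simp add: ennreal_minus_le_iff ac_simps)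
    qed
    also have "\<dots> = ?h u s + ?h v t"
      by (subst nn_integral_add) (auto simp: ac_simps)
    finally show ?thesis .
  qed
  show ?thesis
  proof (rule ennreal_le_epsilon)
    fix e :: real assume fin: "K_functional M a u + K_functional M a v < top" and e: "e > 0"
    have "K_functional M a u < K_functional M a u + ennreal (e/2)"
      "K_functional M a v < K_functional M a v + ennreal (e/2)"
      using fin e by (auto simp: ennreal_add_less_top less_top)
    then obtain s t where st: "s \<ge> 0" "?h u s < K_functional M a u + ennreal (e/2)"
       "t \<ge> 0" "?h v t < K_functional M a v + ennreal (e/2)"
      unfolding K_functional_def INF_less_iff atLeast_iff by blast
    have "?h u s + ?h v t \<le> (K_functional M a u + ennreal (e/2)) + (K_functional M a v + ennreal (e/2))"
      using st(2,4) by (intro add_mono[OF less_imp_le less_imp_le])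
    also have "\<dots> = K_functional M a u + K_functional M a v + (ennreal (e/2) + ennreal (e/2))"
      by (simp add: ac_simps)
    also have "ennreal (e/2) + ennreal (e/2) = ennreal e"
      using e by (simp flip: ennreal_plus)
    finally show "K_functional M a (\<lambda>x. u x + v x) \<le> K_functional M a u + K_functional M a v + ennreal e"
      using *[of s t] st by (meson order.trans)
  qed
qed

lemma K_functional_scale_le:
  assumes [measurable]: "u \<in> borel_measurable M" and c: "c \<ge> 0" and a: "a \<ge> 0"
  shows "K_functional M a (\<lambda>x. ennreal c * u x) \<le> ennreal c * K_functional M a u"
proof (cases "c > 0")
  case True
  have "K_functional M a (\<lambda>x. ennreal c * u x)
      \<le> ennreal c * (ennreal (a * s) + (\<integral>\<^sup>+ x. u x - ennreal s \<partial>M))" if "s \<ge> 0" for s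
  proof -
    have "K_functional M a (\<lambda>x. ennreal c * u x)
      \<le> ennreal (a * (c * s)) + (\<integral>\<^sup>+ x. ennreal c * u x - ennreal (c * s) \<partial>M)"
      using that c by (intro K_functional_le) simp
    also have "(\<lambda>x. ennreal c * u x - ennreal (c * s)) = (\<lambda>x. ennreal c * (u x - ennreal s))"
      using c that by (auto simp: ennreal_mult ennreal_right_diff_distrib)
    also have "ennreal (a * (c * s)) + (\<integral>\<^sup>+ x. ennreal c * (u x - ennreal s) \<partial>M)
      = ennreal c * (ennreal (a * s) + (\<integral>\<^sup>+ x. u x - ennreal s \<partial>M))"
      using c that a by (simp add: nn_integral_cmult distrib_left ennreal_mult ac_simps)
    finally show ?thesis .
  qed
  then show ?thesis
    unfolding K_functional_def
    by (intro le_cmult_INF_ennreal) (use \<open>c > 0\<close> in auto)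
next
  case False
  then show ?thesis using c K_functional_le[of 0 M a "\<lambda>x. 0"] by simp
qed

lemma K_functional_scale:
  assumes [measurable]: "u \<in> borel_measurable M" and c: "c \<ge> 0" and a: "a \<ge> 0"
  shows "K_functional M a (\<lambda>x. ennreal c * u x) = ennreal c * K_functional M a u"
proof (cases "c > 0")
  case True
  have "ennreal c * K_functional M a (\<lambda>x. ennreal (inverse c) * (ennreal c * u x))
      \<le> ennreal c * (ennreal (inverse c) * K_functional M a (\<lambda>x. ennreal c * u x))"
    using True a by (intro mult_left_mono K_functional_scale_le) auto
  then have "ennreal c * K_functional M a u \<le> K_functional M a (\<lambda>x. ennreal c * u x)"
    using True by (simp add: mult.assoc[symmetric] ennreal_mult[symmetric])
  with K_functional_scale_le[OF assms] show ?thesis by (rule antisym)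
next
  case False
  then show ?thesis
    using K_functional_scale_le[OF assms] c by simp
qed

lemma K_functional_zero [simp]: "K_functional M a (\<lambda>x. 0) = 0"
  using K_functional_le[of 0 M a "\<lambda>x. 0"] by simp

lemma K_functional_sum:
  assumes "finite I" "\<And>i. i \<in> I \<Longrightarrow> w i \<in> borel_measurable M" "a \<ge> 0"
  shows "K_functional M a (\<lambda>x. \<Sum>i\<in>I. w i x) \<le> (\<Sum>i\<in>I. K_functional M a (w i))"
  using assms
proof (induction I rule: finite_induct)
  case (insert i I)
  then have "K_functional M a (\<lambda>x. w i x + (\<Sum>i\<in>I. w i x))
      \<le> K_functional M a (w i) + K_functional M a (\<lambda>x. \<Sum>i\<in>I. w i x)"
    by (intro K_functional_add) auto
  also have "\<dots> \<le> K_functional M a (w i) + (\<Sum>i\<in>I. K_functional M a (w i))"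
    using insert by (intro add_left_mono) auto
  finally show ?case using insert by simp
qed simp

text \<open>
  Near-minimisers \<open>s n\<close> for \<open>u n\<close> stay bounded, and a cluster point of them is a near-minimiser for the
  supremum.
\<close>

lemma K_functional_monotone_convergence:
  assumes [measurable]: "\<And>n. u n \<in> borel_measurable M" and inc: "incseq u" and a: "a > 0"
  shows "K_functional M a (\<lambda>x. SUP n. u n x) \<le> (SUP n. K_functional M a (u n))"
proof (cases "(SUP n. K_functional M a (u n)) = top")
  case False
  define B where "B = (SUP n. K_functional M a (u n))"
  have Bfin: "B < top" using False unfolding B_def by (simp only: top.not_eq_extremum)
  let ?h = "\<lambda>u s. ennreal (a * s) + (\<integral>\<^sup>+ x. u x - ennreal s \<partial>M)"
  have "\<exists>s. s \<ge> 0 \<and> ?h (u n) s < B + ennreal (inverse (Suc n))" for n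
  proof -
    have "K_functional M a (u n) \<le> B" unfolding B_def by (rule SUP_upper) simp
    also have "B < B + ennreal (inverse (Suc n))" using Bfin by (auto simp: less_top)
    finally show ?thesis unfolding K_functional_def INF_less_iff by auto
  qed
  then obtain s where s: "\<And>n. s n \<ge> 0" "\<And>n. ?h (u n) (s n) < B + ennreal (inverse (Suc n))"
    by metis
  have "s n \<in> {0..(enn2real B + 1) / a}" for n
  proof -
    have "ennreal (a * s n) \<le> B + ennreal (inverse (Suc n))"
      using s(2)[of n] by (meson add_increasing2 le_less order_trans zero_le)
    also have "\<dots> \<le> B + ennreal 1"
      by (intro add_left_mono ennreal_leI) (simp add: inverse_le_1_iff)
    also have "\<dots> = ennreal (enn2real B + 1)"
      using Bfin by (simp add: ennreal_plus ennreal_enn2real)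
    finally have "a * s n \<le> enn2real B + 1"
      by (rule ennreal_le_iff[THEN iffD1, rotated]) simp
    then show ?thesis using s(1)[of n] a by (simp add: field_simps)
  qed
  then obtain \<sigma> r where r: "\<sigma> \<in> {0..(enn2real B + 1) / a}" "strict_mono r" "(s \<circ> r) \<longlonglongrightarrow> \<sigma>"
    using compact_imp_seq_compact[OF compact_Icc] unfolding seq_compact_def by metis
  have main: "K_functional M a (\<lambda>x. SUP n. u n x) \<le> B + ennreal (e + 2 * a * e)" if e: "e > 0" for e
  proof -
    have fin: "?h (u m) (\<sigma> + e) \<le> B + ennreal (e + 2 * a * e)" for m
    proof -
      have "eventually (\<lambda>n. dist ((s \<circ> r) n) \<sigma> < e \<and> inverse (real (Suc n)) < e \<and> n \<ge> m) sequentially"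
        using tendstoD[OF r(3) e] order_tendstoD(2)[OF LIMSEQ_inverse_real_of_nat e]
          eventually_ge_at_top[of m] by eventually_elim auto
      then obtain n where n: "dist ((s \<circ> r) n) \<sigma> < e" "inverse (real (Suc n)) < e" "n \<ge> m"
        by (auto dest!: eventually_happens)
      have rn: "n \<le> r n" using r(2) by (rule seq_suble)
      have ir: "inverse (real (Suc (r n))) \<le> e"
        using n(2) rn le_imp_inverse_le[of "real (Suc n)" "real (Suc (r n))"] by linarith
      have d: "\<bar>s (r n) - \<sigma>\<bar> < e" using n(1) by (simp add: dist_real_def)
      have "?h (u m) (\<sigma> + e) \<le> ennreal (a * s (r n) + 2 * a * e) + (\<integral>\<^sup>+ x. u (r n) x - ennreal (s (r n)) \<partial>M)"
      proof (intro add_mono nn_integral_mono ennreal_leI ennreal_minus_mono)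
        have "a * (\<sigma> + e) \<le> a * (s (r n) + 2 * e)"
          using a d by (intro mult_left_mono) auto
        then show "a * (\<sigma> + e) \<le> a * s (r n) + 2 * a * e" by (simp add: algebra_simps)
        show "u m x \<le> u (r n) x" for x using inc rn n(3) by (auto simp: incseq_def le_fun_def)
      qed (use d in auto)
      also have "\<dots> = ?h (u (r n)) (s (r n)) + ennreal (2 * a * e)"
        using a s(1)[of "r n"] e by (simp add: ennreal_plus ac_simps)
      also have "\<dots> \<le> (B + ennreal e) + ennreal (2 * a * e)"
        using s(2)[of "r n"] ir
        by (intro add_right_mono order_trans[OF less_imp_le[OF s(2)]] add_left_mono ennreal_leI) auto
      finally show ?thesis using a e by (simp add: ennreal_plus ac_simps)
    qed
    have "K_functional M a (\<lambda>x. SUP n. u n x) \<le> ?h (\<lambda>x. SUP n. u n x) (\<sigma> + e)"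
      using r(1) e by (intro K_functional_le) auto
    also have "\<dots> = ennreal (a * (\<sigma> + e)) + (SUP n. \<integral>\<^sup>+ x. u n x - ennreal (\<sigma> + e) \<partial>M)"
      using inc
      by (subst SUP_diff_ennreal[symmetric], simp, subst nn_integral_monotone_convergence_SUP)
         (auto simp: incseq_def le_fun_def intro: ennreal_minus_mono)
    also have "\<dots> = (SUP n. ?h (u n) (\<sigma> + e))"
      by (simp add: ennreal_SUP_add_right)
    also have "\<dots> \<le> B + ennreal (e + 2 * a * e)"
      using fin by (rule SUP_least)
    finally show ?thesis .
  qed
  have "K_functional M a (\<lambda>x. SUP n. u n x) \<le> B"
  proof (rule ennreal_le_epsilon)
    fix e :: real assume "e > 0"
    moreover have "e / (1 + 2 * a) + 2 * a * (e / (1 + 2 * a)) = (e / (1 + 2 * a)) * (1 + 2 * a)"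
      by (simp only: distrib_left mult_1_right mult.commute[of _ "e / (1 + 2 * a)"])
    then have "e / (1 + 2 * a) + 2 * a * (e / (1 + 2 * a)) = e"
      using a by simp
    ultimately show "K_functional M a (\<lambda>x. SUP n. u n x) \<le> B + ennreal e"
      using main[of "e / (1 + 2 * a)"] a by auto
  qed
  then show ?thesis by (simp add: B_def)
next
  case True
  then show ?thesis by (simp only: top_greatest)
qed

lemma K_functional_indicator_le:
  assumes [measurable]: "A \<in> sets M" and a: "a \<ge> 0"
  shows "K_functional M a (indicator A) \<le> min (ennreal a) (emeasure M A)"
proof (rule min.boundedI)
  have "indicator A x - 1 = (0 :: ennreal)" for x by (auto simp: indicator_def)
  then show "K_functional M a (indicator A) \<le> ennreal a"
    using K_functional_le[of 1 M a "indicator A"] by (simp)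
  show "K_functional M a (indicator A) \<le> emeasure M A"
    using K_functional_le[of 0 M a "indicator A"] by simp
qed

lemma K_functional_indicator_ge:
  assumes [measurable]: "A \<in> sets M" and A: "emeasure M A = ennreal a" and a: "a \<ge> 0" and v: "v \<ge> 0"
  shows "ennreal (a * v) \<le> K_functional M a (\<lambda>x. ennreal v * indicator A x)"
proof (rule le_K_functional)
  fix s :: real assume s: "s \<ge> 0"
  have eq: "ennreal v * indicator A x - ennreal s = (ennreal v - ennreal s) * indicator A x" for x
    by (auto simp: indicator_def)
  have "ennreal (a * v) \<le> ennreal (a * s + max 0 (v - s) * a)"
  proof (intro ennreal_leI)
    have "a * (v - s) \<le> a * max 0 (v - s)" using a by (intro mult_left_mono) auto
    then show "a * v \<le> a * s + max 0 (v - s) * a" by (simp add: algebra_simps)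
  qed
  also have "\<dots> = ennreal (a * s) + ennreal (max 0 (v - s)) * ennreal a"
    using a s by (subst ennreal_plus) (auto simp: ennreal_mult)
  also have "ennreal (max 0 (v - s)) = ennreal v - ennreal s"
    using s by (simp add: ennreal_minus max_def ennreal_neg)
  finally show "ennreal (a * v) \<le> ennreal (a * s) + (\<integral>\<^sup>+ x. ennreal v * indicator A x - ennreal s \<partial>M)"
    unfolding eq by (simp add: nn_integral_cmult_indicator A)
qed

lemma set_nn_integral_le_K_functional:
  assumes [measurable]: "A \<in> sets M" "u \<in> borel_measurable M" and A: "emeasure M A = ennreal m" and a: "a > 0" and m: "m \<ge> 0"
  shows "(\<integral>\<^sup>+ x\<in>A. u x \<partial>M) \<le> ennreal (max 1 (m / a)) * K_functional M a u"
proof -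
  have "(\<integral>\<^sup>+ x\<in>A. u x \<partial>M) \<le> ennreal (max 1 (m / a)) * (ennreal (a * s) + (\<integral>\<^sup>+ x. u x - ennreal s \<partial>M))"
    if s: "s \<ge> 0" for s
  proof -
    have "(\<integral>\<^sup>+ x\<in>A. u x \<partial>M) \<le> (\<integral>\<^sup>+ x. ennreal s * indicator A x + (u x - ennreal s) \<partial>M)"
      by (intro nn_integral_mono) (auto simp: indicator_def add_diff_self_ennreal)
    also have "\<dots> = ennreal (m * s) + (\<integral>\<^sup>+ x. u x - ennreal s \<partial>M)"
      using s m by (subst nn_integral_add) (auto simp: nn_integral_cmult_indicator A ennreal_mult ac_simps)
    also have "\<dots> \<le> ennreal (max 1 (m / a)) * ennreal (a * s) + ennreal (max 1 (m / a)) * (\<integral>\<^sup>+ x. u x - ennreal s \<partial>M)"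
    proof (intro add_mono)
      have "(m / a) * (a * s) \<le> max 1 (m / a) * (a * s)"
        using s a by (intro mult_right_mono) auto
      then show "ennreal (m * s) \<le> ennreal (max 1 (m / a)) * ennreal (a * s)"
        using a s by (subst ennreal_mult[symmetric]) (auto intro!: ennreal_leI)
      show "(\<integral>\<^sup>+ x. u x - ennreal s \<partial>M) \<le> ennreal (max 1 (m / a)) * (\<integral>\<^sup>+ x. u x - ennreal s \<partial>M)"
        using mult_right_mono[of "ennreal 1" "ennreal (max 1 (m / a))" "(\<integral>\<^sup>+ x. u x - ennreal s \<partial>M)"]
        by (simp add: ennreal_leI del: ennreal_1) simp
    qed
    finally show ?thesis by (simp add: distrib_left)
  qed
  then show ?thesis
    unfolding K_functional_def by (intro le_cmult_INF_ennreal) auto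
qed

lemma nn_integral_truncated_layer_cake:
  assumes "sigma_finite_measure M" and [measurable]: "f \<in> borel_measurable M" and s: "s \<ge> 0"
  shows "(\<integral>\<^sup>+ x. ennreal (f x) - ennreal s \<partial>M)
    = (\<integral>\<^sup>+ t\<in>{s..}. emeasure M {x \<in> space M. f x > t} \<partial>lborel)"
proof -
  interpret M: sigma_finite_measure M by fact
  interpret pair_sigma_finite M lborel ..
  have "(\<integral>\<^sup>+ x. ennreal (f x) - ennreal s \<partial>M) = (\<integral>\<^sup>+ x. (\<integral>\<^sup>+ t. indicator {s..<f x} t \<partial>lborel) \<partial>M)"
  proof (intro nn_integral_cong)
    fix x
    show "ennreal (f x) - ennreal s = (\<integral>\<^sup>+ t. indicator {s..<f x} t \<partial>lborel)"
      using s by (cases "s \<le> f x") (auto simp: ennreal_minus ennreal_neg)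
  qed
  also have "\<dots> = (\<integral>\<^sup>+ x. (\<integral>\<^sup>+ t. (if s \<le> t \<and> t < f x then 1 else 0) \<partial>lborel) \<partial>M)"
    by (intro nn_integral_cong) (auto simp: indicator_def)
  also have "\<dots> = (\<integral>\<^sup>+ t. (\<integral>\<^sup>+ x. (if s \<le> t \<and> t < f x then 1 else 0) \<partial>M) \<partial>lborel)"
    by (rule Fubini'[symmetric]) measurable
  also have "\<dots> = (\<integral>\<^sup>+ t. (\<integral>\<^sup>+ x. indicator {s..} t * indicator {x \<in> space M. f x > t} x \<partial>M) \<partial>lborel)"
    by (intro nn_integral_cong) (auto simp: indicator_def)
  also have "\<dots> = (\<integral>\<^sup>+ t\<in>{s..}. emeasure M {x \<in> space M. f x > t} \<partial>lborel)"
    by (intro nn_integral_cong) (simp add: nn_integral_cmult_indicator mult.commute)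
  finally show ?thesis .
qed

lemma K_functional_equidistributed:
  assumes "sigma_finite_measure M" "f \<in> borel_measurable M" "g \<in> borel_measurable M"
    and "\<And>t. t \<ge> 0 \<Longrightarrow> emeasure M {x \<in> space M. f x > t} = emeasure M {x \<in> space M. g x > t}"
  shows "K_functional M a (\<lambda>x. ennreal (f x)) = K_functional M a (\<lambda>x. ennreal (g x))"
proof -
  have "(\<integral>\<^sup>+ x. ennreal (f x) - ennreal s \<partial>M) = (\<integral>\<^sup>+ x. ennreal (g x) - ennreal s \<partial>M)" if "s \<ge> 0" for s
    using assms that
    by (auto simp: nn_integral_truncated_layer_cake indicator_def intro!: nn_integral_cong)
  then show ?thesis unfolding K_functional_def by (intro INF_cong) auto
qed

section \<open>Function norms\<close>

lemma sets_half_line_Icc [measurable, simp]: "{0..c} \<in> sets half_line"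
  by (simp add: sets_restrict_space_iff)

lemma emeasure_half_line_Icc: "c \<ge> 0 \<Longrightarrow> emeasure half_line {0..c} = ennreal c"
  by (subst emeasure_restrict_space) auto

lemma sigma_finite_half_line: "sigma_finite_measure half_line"
proof
  show "\<exists>A. countable A \<and> A \<subseteq> sets half_line \<and> \<Union> A = space half_line \<and> (\<forall>a\<in>A. emeasure half_line a \<noteq> \<infinity>)"
    by (intro exI[of _ "range (\<lambda>n. {0..real n})"])
      (auto simp: emeasure_half_line_Icc real_arch_simple)
qed

locale ri_function_norm =
  fixes \<rho> :: "(real \<Rightarrow> ennreal) \<Rightarrow> ennreal"
  assumes \<rho>_mono: "u \<in> borel_measurable half_line \<Longrightarrow> v \<in> borel_measurable half_line \<Longrightarrow>
      AE x in half_line. u x \<le> v x \<Longrightarrow> \<rho> u \<le> \<rho> v"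
    and \<rho>_scale: "u \<in> borel_measurable half_line \<Longrightarrow> c \<ge> 0 \<Longrightarrow>
      \<rho> (\<lambda>x. ennreal c * u x) = ennreal c * \<rho> u"
    and \<rho>_add: "u \<in> borel_measurable half_line \<Longrightarrow> v \<in> borel_measurable half_line \<Longrightarrow>
      \<rho> (\<lambda>x. u x + v x) \<le> \<rho> u + \<rho> v"
    and \<rho>_SUP: "(\<And>n::nat. w n \<in> borel_measurable half_line) \<Longrightarrow> incseq w \<Longrightarrow>
      \<rho> (\<lambda>x. SUP n. w n x) \<le> (SUP n. \<rho> (w n))"
    and \<rho>_indicator: "A \<in> sets half_line \<Longrightarrow> emeasure half_line A < \<infinity> \<Longrightarrow> \<rho> (indicator A) < \<infinity>"
    and \<rho>_locally_integrable: "A \<in> sets half_line \<Longrightarrow> emeasure half_line A < \<infinity> \<Longrightarrow>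
      \<exists>C. \<forall>u\<in>borel_measurable half_line. (\<integral>\<^sup>+ x\<in>A. u x \<partial>half_line) \<le> ennreal C * \<rho> u"
    and \<rho>_equidistributed: "f \<in> borel_measurable half_line \<Longrightarrow> g \<in> borel_measurable half_line \<Longrightarrow>
      (\<And>t. t \<ge> 0 \<Longrightarrow> emeasure half_line {x \<in> space half_line. f x > t}
          = emeasure half_line {x \<in> space half_line. g x > t}) \<Longrightarrow>
      \<rho> (\<lambda>x. ennreal (f x)) = \<rho> (\<lambda>x. ennreal (g x))"
begin

lemma \<rho>_cong_AE:
  assumes "u \<in> borel_measurable half_line" "v \<in> borel_measurable half_line"
    and "AE x in half_line. u x = v x"
  shows "\<rho> u = \<rho> v"
  using assms by (intro antisym \<rho>_mono) (auto elim: eventually_mono)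

lemma \<rho>_zero [simp]: "\<rho> (\<lambda>x. 0) = 0"
  using \<rho>_scale[of "\<lambda>x. 0" 0] by simp

lemma \<rho>_finite_imp_set_nn_integral:
  assumes "u \<in> borel_measurable half_line"
  obtains C where "(\<integral>\<^sup>+ x\<in>{0..real n}. u x \<partial>half_line) \<le> ennreal C * \<rho> u"
proof -
  have "emeasure half_line {0..real n} < \<infinity>"
    by (subst emeasure_restrict_space) auto
  then show ?thesis
    using \<rho>_locally_integrable[of "{0..real n}"] assms that
    by (fastforce simp: sets_restrict_space_iff)
qed

lemma AE_half_lineI:
  assumes "\<And>n::nat. AE x in half_line. x \<le> real n \<longrightarrow> P x"
  shows "AE x in half_line. P x"
proof -
  have "AE x in half_line. \<forall>n::nat. x \<le> real n \<longrightarrow> P x"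
    by (intro AE_all_countable[THEN iffD2] allI assms)
  then show ?thesis
    by eventually_elim (meson real_arch_simple)
qed

lemma \<rho>_eq_0_imp_AE:
  assumes [measurable]: "u \<in> borel_measurable half_line" and "\<rho> u = 0"
  shows "AE x in half_line. u x = 0"
proof (rule AE_half_lineI)
  fix n
  obtain C where "(\<integral>\<^sup>+ x\<in>{0..real n}. u x \<partial>half_line) \<le> ennreal C * \<rho> u"
    by (rule \<rho>_finite_imp_set_nn_integral[OF assms(1)])
  then have "(\<integral>\<^sup>+ x\<in>{0..real n}. u x \<partial>half_line) = 0" using assms by simp
  moreover have [measurable]: "{0..real n} \<in> sets half_line" by (simp add: sets_restrict_space_iff)
  ultimately have "AE x in half_line. u x * indicator {0..real n} x = 0"
    by (subst (asm) nn_integral_0_iff_AE) auto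
  moreover have "AE x in half_line. x \<ge> 0" by (rule AE_I2) simp
  ultimately show "AE x in half_line. x \<le> real n \<longrightarrow> u x = 0"
    by eventually_elim (auto simp: indicator_def split: if_splits)
qed

lemma \<rho>_finite_imp_AE:
  assumes [measurable]: "u \<in> borel_measurable half_line" and "\<rho> u < \<infinity>"
  shows "AE x in half_line. u x < \<infinity>"
proof (rule AE_half_lineI)
  fix n
  obtain C where "(\<integral>\<^sup>+ x\<in>{0..real n}. u x \<partial>half_line) \<le> ennreal C * \<rho> u"
    by (rule \<rho>_finite_imp_set_nn_integral[OF assms(1)])
  also have "\<dots> < \<infinity>" using assms by (simp add: ennreal_mult_less_top)
  finally have "(\<integral>\<^sup>+ x\<in>{0..real n}. u x \<partial>half_line) \<noteq> \<infinity>" by simp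
  moreover have [measurable]: "{0..real n} \<in> sets half_line" by (simp add: sets_restrict_space_iff)
  ultimately have "AE x in half_line. u x * indicator {0..real n} x \<noteq> \<infinity>"
    by (intro nn_integral_noteq_infinite) auto
  moreover have "AE x in half_line. x \<ge> 0" by (rule AE_I2) simp
  ultimately show "AE x in half_line. x \<le> real n \<longrightarrow> u x < \<infinity>"
    by eventually_elim (auto simp: indicator_def less_top split: if_splits)
qed

lemma \<rho>_sum:
  assumes "finite I" "\<And>i. i \<in> I \<Longrightarrow> w i \<in> borel_measurable half_line"
  shows "\<rho> (\<lambda>x. \<Sum>i\<in>I. w i x) \<le> (\<Sum>i\<in>I. \<rho> (w i))"
  using assms
proof (induction I rule: finite_induct)
  case (insert i I)
  then have "\<rho> (\<lambda>x. w i x + (\<Sum>i\<in>I. w i x)) \<le> \<rho> (w i) + \<rho> (\<lambda>x. \<Sum>i\<in>I. w i x)"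
    by (intro \<rho>_add) auto
  also have "\<dots> \<le> \<rho> (w i) + (\<Sum>i\<in>I. \<rho> (w i))"
    using insert by (intro add_left_mono) auto
  finally show ?case using insert by simp
qed simp

lemma \<rho>_suminf:
  assumes [measurable]: "\<And>n::nat. w n \<in> borel_measurable half_line"
  shows "\<rho> (\<lambda>x. \<Sum>n. w n x) \<le> (\<Sum>n. \<rho> (w n))"
proof -
  have "\<rho> (\<lambda>x. SUP n. \<Sum>i<n. w i x) \<le> (SUP n. \<rho> (\<lambda>x. \<Sum>i<n. w i x))"
    by (intro \<rho>_SUP) (auto simp: incseq_def le_fun_def intro!: sum_mono2)
  also have "\<dots> \<le> (SUP n. \<Sum>i<n. \<rho> (w i))"
    by (intro SUP_mono') (auto intro!: \<rho>_sum)
  finally show ?thesis by (simp add: suminf_eq_SUP)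
qed

lemma \<rho>_liminf:
  assumes [measurable]: "\<And>n::nat. w n \<in> borel_measurable half_line"
  shows "\<rho> (\<lambda>x. liminf (\<lambda>n. w n x)) \<le> liminf (\<lambda>n. \<rho> (w n))"
proof -
  have "\<rho> (\<lambda>x. SUP n. INF m\<in>{n..}. w m x) \<le> (SUP n. \<rho> (\<lambda>x. INF m\<in>{n..}. w m x))"
    by (intro \<rho>_SUP) (auto simp: incseq_def le_fun_def intro!: INF_superset_mono)
  also have "\<dots> \<le> (SUP n. INF m\<in>{n..}. \<rho> (w m))"
    by (intro SUP_mono' INF_greatest \<rho>_mono AE_I2) (auto intro: INF_lower)
  finally show ?thesis by (simp add: liminf_SUP_INF)
qed

definition carrier :: "(real \<Rightarrow> complex) set" where
  "carrier = {f \<in> borel_measurable half_line. \<rho> (\<lambda>x. ennreal (cmod (f x))) < \<infinity>}"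

definition fnorm :: "(real \<Rightarrow> complex) \<Rightarrow> real" where
  "fnorm f = enn2real (\<rho> (\<lambda>x. ennreal (cmod (f x))))"

lemma fnorm_nonneg [simp]: "0 \<le> fnorm f"
  by (simp add: fnorm_def)

lemma ennreal_fnorm: "f \<in> carrier \<Longrightarrow> ennreal (fnorm f) = \<rho> (\<lambda>x. ennreal (cmod (f x)))"
  by (simp add: carrier_def fnorm_def)

lemma carrier_ideal:
  assumes "g \<in> carrier" and [measurable]: "f \<in> borel_measurable half_line"
    and "AE x in half_line. cmod (f x) \<le> cmod (g x)"
  shows "f \<in> carrier" "fnorm f \<le> fnorm g"
proof -
  have le: "\<rho> (\<lambda>x. ennreal (cmod (f x))) \<le> \<rho> (\<lambda>x. ennreal (cmod (g x)))"
    using assms by (intro \<rho>_mono) (auto elim!: eventually_mono simp: carrier_def)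
  then show "f \<in> carrier" "fnorm f \<le> fnorm g"
    using assms by (auto simp: carrier_def fnorm_def intro!: enn2real_mono)
qed

lemma carrier_add:
  assumes "f \<in> carrier" "g \<in> carrier"
  shows "(\<lambda>x. f x + g x) \<in> carrier" "fnorm (\<lambda>x. f x + g x) \<le> fnorm f + fnorm g"
proof -
  have [measurable]: "f \<in> borel_measurable half_line" "g \<in> borel_measurable half_line"
    using assms by (auto simp: carrier_def)
  have "\<rho> (\<lambda>x. ennreal (cmod (f x + g x))) \<le> \<rho> (\<lambda>x. ennreal (cmod (f x)) + ennreal (cmod (g x)))"
    by (intro \<rho>_mono AE_I2) (auto simp: norm_triangle_ineq simp flip: ennreal_plus)
  also have "\<dots> \<le> \<rho> (\<lambda>x. ennreal (cmod (f x))) + \<rho> (\<lambda>x. ennreal (cmod (g x)))"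
    by (intro \<rho>_add) auto
  also have "\<dots> = ennreal (fnorm f + fnorm g)"
    using assms by (simp add: ennreal_plus ennreal_fnorm)
  finally have *: "\<rho> (\<lambda>x. ennreal (cmod (f x + g x))) \<le> ennreal (fnorm f + fnorm g)" .
  then show "(\<lambda>x. f x + g x) \<in> carrier" by (auto simp: carrier_def le_less_trans)
  show "fnorm (\<lambda>x. f x + g x) \<le> fnorm f + fnorm g"
    using * by (subst fnorm_def) (intro enn2real_leI; simp)
qed

lemma carrier_scale:
  assumes "f \<in> carrier"
  shows "(\<lambda>x. a * f x) \<in> carrier" "fnorm (\<lambda>x. a * f x) = cmod a * fnorm f"
proof -
  have [measurable]: "f \<in> borel_measurable half_line" using assms by (auto simp: carrier_def)
  have *: "\<rho> (\<lambda>x. ennreal (cmod (a * f x))) = ennreal (cmod a) * \<rho> (\<lambda>x. ennreal (cmod (f x)))"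
    by (subst \<rho>_scale[symmetric]) (auto simp: norm_mult ennreal_mult)
  then show "(\<lambda>x. a * f x) \<in> carrier" "fnorm (\<lambda>x. a * f x) = cmod a * fnorm f"
    using assms by (auto simp: carrier_def fnorm_def ennreal_mult_less_top enn2real_mult)
qed

lemma carrier_diff: "f \<in> carrier \<Longrightarrow> g \<in> carrier \<Longrightarrow> (\<lambda>x. f x - g x) \<in> carrier"
  using carrier_add(1)[of f "\<lambda>x. (-1) * g x"] carrier_scale(1)[of g "-1"] by simp

lemma carrier_fatou:
  assumes s: "\<And>n::nat. s n \<in> carrier" and [measurable]: "f \<in> borel_measurable half_line"
    and inc: "\<And>n. AE x in half_line. cmod (s n x) \<le> cmod (s (Suc n) x)"
    and lim: "AE x in half_line. (\<lambda>n. cmod (s n x)) \<longlonglongrightarrow> cmod (f x)"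
    and B: "\<And>n. fnorm (s n) \<le> B"
  shows "f \<in> carrier" "(\<lambda>n. fnorm (s n)) \<longlonglongrightarrow> fnorm f"
proof -
  have [measurable]: "s n \<in> borel_measurable half_line" for n using s by (auto simp: carrier_def)
  let ?r = "\<lambda>f. \<rho> (\<lambda>x. ennreal (cmod (f x)))"
  have "AE x in half_line. \<forall>n. cmod (s n x) \<le> cmod (s (Suc n) x)"
    using inc by (simp add: AE_all_countable)
  with lim have AE: "AE x in half_line. incseq (\<lambda>n. cmod (s n x)) \<and> (\<lambda>n. cmod (s n x)) \<longlonglongrightarrow> cmod (f x)"
    by eventually_elim (auto intro: incseq_SucI)
  have mono: "?r (s m) \<le> ?r (s n)" if "m \<le> n" for m n
    using AE that by (intro \<rho>_mono) (auto elim!: eventually_mono simp: incseq_def)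
  have le: "?r (s n) \<le> ?r f" for n
  proof (intro \<rho>_mono)
    show "AE x in half_line. ennreal (cmod (s n x)) \<le> ennreal (cmod (f x))"
      using AE by eventually_elim (auto intro: incseq_le)
  qed measurable
  have "?r f = \<rho> (\<lambda>x. liminf (\<lambda>n. ennreal (cmod (s n x))))"
    using lim by (intro \<rho>_cong_AE) (auto elim!: eventually_mono intro!: lim_imp_Liminf[symmetric])
  also have "\<dots> \<le> liminf (\<lambda>n. ?r (s n))" by (rule \<rho>_liminf) simp
  finally have *: "?r f \<le> liminf (\<lambda>n. ?r (s n))" .
  have SUP: "(\<lambda>n. ?r (s n)) \<longlonglongrightarrow> (SUP n. ?r (s n))"
    using mono by (intro LIMSEQ_SUP) (simp add: incseq_def)
  then have "?r f = (SUP n. ?r (s n))"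
    using * le by (intro antisym SUP_least) (simp_all add: lim_imp_Liminf)
  with SUP have conv: "(\<lambda>n. ?r (s n)) \<longlonglongrightarrow> ?r f" by simp
  have "?r (s n) \<le> ennreal B" for n
    using s B[of n] by (simp add: ennreal_leI flip: ennreal_fnorm)
  then have "?r f \<le> ennreal B"
    using conv by (intro LIMSEQ_le_const2) auto
  then show "f \<in> carrier" by (auto simp: carrier_def le_less_trans)
  then show "(\<lambda>n. fnorm (s n)) \<longlonglongrightarrow> fnorm f"
    unfolding fnorm_def using conv by (intro tendsto_enn2real) (auto simp: carrier_def)
qed

lemma carrier_complete:
  assumes s: "\<And>n::nat. s n \<in> carrier"
    and cauchy: "\<And>e. e > 0 \<Longrightarrow> \<exists>K. \<forall>m\<ge>K. \<forall>n\<ge>K. fnorm (\<lambda>x. s m x - s n x) < e"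
  shows "\<exists>f\<in>carrier. (\<lambda>n. fnorm (\<lambda>x. s n x - f x)) \<longlonglongrightarrow> 0"
proof -
  have [measurable]: "s n \<in> borel_measurable half_line" for n using s by (auto simp: carrier_def)
  let ?r = "\<lambda>f. \<rho> (\<lambda>x. ennreal (cmod (f x)))"
  have cauchy': "\<exists>K. \<forall>m\<ge>K. \<forall>n\<ge>K. ?r (\<lambda>x. s m x - s n x) \<le> ennreal e" if e: "e > 0" for e
  proof -
    obtain K where K: "\<forall>m\<ge>K. \<forall>n\<ge>K. fnorm (\<lambda>x. s m x - s n x) < e" using cauchy[OF e] by auto
    have "?r (\<lambda>x. s m x - s n x) \<le> ennreal e" if "m \<ge> K" "n \<ge> K" for m n
    proof -
      have "?r (\<lambda>x. s m x - s n x) = ennreal (fnorm (\<lambda>x. s m x - s n x))"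
        using s by (intro ennreal_fnorm[symmetric] carrier_diff)
      also have "\<dots> \<le> ennreal e" using K that by (intro ennreal_leI) (auto intro: less_imp_le)
      finally show ?thesis .
    qed
    then show ?thesis by auto
  qed
  have "\<forall>k. \<exists>K. \<forall>m\<ge>K. \<forall>n\<ge>K. ?r (\<lambda>x. s m x - s n x) \<le> ennreal ((1/2) ^ k)"
    using cauchy' by simp
  then obtain K where K: "\<And>k m n. m \<ge> K k \<Longrightarrow> n \<ge> K k \<Longrightarrow> ?r (\<lambda>x. s m x - s n x) \<le> ennreal ((1/2) ^ k)"
    by metis
  define r where "r k = k + (\<Sum>j\<le>k. K j)" for k
  have r_ge: "r k \<ge> k" for k by (simp add: r_def)
  have rK: "r k \<ge> K j" if "j \<le> k" for j k
    using member_le_sum[of j "{..k}" K] that by (simp add: r_def)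
  define d where "d k x = s (r (Suc k)) x - s (r k) x" for k x
  have [measurable]: "d k \<in> borel_measurable half_line" for k unfolding d_def by measurable
  have "\<rho> (\<lambda>x. \<Sum>k. ennreal (cmod (d k x))) \<le> (\<Sum>k. ?r (d k))" by (rule \<rho>_suminf) simp
  also have "\<dots> \<le> (\<Sum>k. ennreal ((1/2) ^ k))"
    unfolding d_def by (intro suminf_le K rK) auto
  also have "\<dots> < \<infinity>"
    by (subst suminf_ennreal2) auto
  finally have "AE x in half_line. (\<Sum>k. ennreal (cmod (d k x))) < \<infinity>"
    by (intro \<rho>_finite_imp_AE) auto
  then have conv: "AE x in half_line. convergent (\<lambda>n. s (r n) x)"
  proof eventually_elim
    case (elim x)
    then have "summable (\<lambda>k. cmod (d k x))" by (intro summable_suminf_not_top) auto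
    then have "summable (\<lambda>k. d k x)" by (rule summable_norm_cancel)
    then have "convergent (\<lambda>n. \<Sum>k<n. d k x)" by (simp add: summable_iff_convergent)
    moreover have "(\<Sum>k<n. d k x) = s (r n) x - s (r 0) x" for n
      unfolding d_def by (rule sum_lessThan_telescope)
    ultimately have "convergent (\<lambda>n. (s (r n) x - s (r 0) x) + s (r 0) x)"
      by (intro convergent_add convergent_const) simp
    then show ?case by simp
  qed
  define f where "f x = lim (\<lambda>n. s (r n) x)" for x
  have [measurable]: "f \<in> borel_measurable half_line"
    unfolding f_def by (rule borel_measurable_lim_metric) simp
  have lim: "AE x in half_line. (\<lambda>n. s (r n) x) \<longlonglongrightarrow> f x"
    using conv by eventually_elim (simp add: f_def convergent_LIMSEQ_iff)
  have tail: "\<exists>K. \<forall>n\<ge>K. ?r (\<lambda>x. s n x - f x) \<le> ennreal e" if e: "e > 0" for e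
  proof -
    obtain K where K: "\<And>m n. m \<ge> K \<Longrightarrow> n \<ge> K \<Longrightarrow> ?r (\<lambda>x. s m x - s n x) \<le> ennreal e"
      using cauchy'[OF e] by auto
    have "?r (\<lambda>x. s n x - f x) \<le> ennreal e" if n: "n \<ge> K" for n
    proof -
      have "?r (\<lambda>x. s n x - f x) = \<rho> (\<lambda>x. liminf (\<lambda>m. ennreal (cmod (s n x - s (r m) x))))"
        using lim by (intro \<rho>_cong_AE)
          (auto elim!: eventually_mono intro!: lim_imp_Liminf[symmetric] tendsto_intros)
      also have "\<dots> \<le> liminf (\<lambda>m. ?r (\<lambda>x. s n x - s (r m) x))" by (rule \<rho>_liminf) simp
      also have "\<dots> \<le> liminf (\<lambda>m. ennreal e)"
      proof (intro Liminf_mono)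
        show "\<forall>\<^sub>F m in sequentially. ?r (\<lambda>x. s n x - s (r m) x) \<le> ennreal e"
          using eventually_ge_at_top[of K]
        proof eventually_elim
          case (elim m)
          then show ?case using r_ge[of m] n by (intro K) auto
        qed
      qed
      also have "\<dots> = ennreal e" by (simp add: Liminf_const)
      finally show ?thesis .
    qed
    then show ?thesis by auto
  qed
  have diff: "\<exists>K. \<forall>n\<ge>K. (\<lambda>x. s n x - f x) \<in> carrier \<and> fnorm (\<lambda>x. s n x - f x) \<le> e" if e: "e > 0" for e
  proof -
    obtain K where K: "\<And>n. n \<ge> K \<Longrightarrow> ?r (\<lambda>x. s n x - f x) \<le> ennreal e" using tail[OF e] by auto
    show ?thesis
    proof (intro exI allI impI conjI)
      fix n assume n: "n \<ge> K"
      show "(\<lambda>x. s n x - f x) \<in> carrier" using K[OF n] by (auto simp: carrier_def le_less_trans)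
      show "fnorm (\<lambda>x. s n x - f x) \<le> e"
        using enn2real_mono[OF K[OF n]] e by (simp add: fnorm_def)
    qed
  qed
  show ?thesis
  proof (intro bexI)
    obtain n where "(\<lambda>x. s n x - f x) \<in> carrier" using diff[of 1] by auto
    from carrier_diff[OF s[of n] this] show "f \<in> carrier" by simp
    show "(\<lambda>n. fnorm (\<lambda>x. s n x - f x)) \<longlonglongrightarrow> 0"
    proof (rule LIMSEQ_I)
      fix e :: real assume "e > 0"
      then obtain K where "\<forall>n\<ge>K. fnorm (\<lambda>x. s n x - f x) \<le> e/2" using diff[of "e/2"] by auto
      then show "\<exists>K. \<forall>n\<ge>K. norm (fnorm (\<lambda>x. s n x - f x) - 0) < e"
        using \<open>e > 0\<close> by (intro exI[of _ K]) (fastforce simp: fnorm_def)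
    qed
  qed
qed

lemma ri_banach_space_carrier: "ri_banach_space carrier fnorm"
proof
  fix f g :: "real \<Rightarrow> complex" and a :: complex and A :: "real set"
  show "f \<in> borel_measurable half_line" if "f \<in> carrier" using that by (simp add: carrier_def)
  show "(\<lambda>x. 0) \<in> carrier" by (simp add: carrier_def)
  show "(\<lambda>x. f x + g x) \<in> carrier" "fnorm (\<lambda>x. f x + g x) \<le> fnorm f + fnorm g"
    if "f \<in> carrier" "g \<in> carrier" using that by (auto intro: carrier_add)
  show "(\<lambda>x. a * f x) \<in> carrier" "fnorm (\<lambda>x. a * f x) = cmod a * fnorm f"
    if "f \<in> carrier" using that by (auto intro: carrier_scale)
  show "fnorm f \<ge> 0" by (simp add: fnorm_def)
  show "fnorm f = 0 \<longleftrightarrow> (AE x in half_line. f x = 0)" if f: "f \<in> carrier"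
  proof -
    have [measurable]: "f \<in> borel_measurable half_line" using f by (simp add: carrier_def)
    have "fnorm f = 0 \<longleftrightarrow> \<rho> (\<lambda>x. ennreal (cmod (f x))) = 0"
      using f by (auto simp: fnorm_def carrier_def enn2real_eq_0_iff)
    also have "\<dots> \<longleftrightarrow> (AE x in half_line. ennreal (cmod (f x)) = 0)"
    proof
      assume "AE x in half_line. ennreal (cmod (f x)) = 0"
      then have "\<rho> (\<lambda>x. ennreal (cmod (f x))) = \<rho> (\<lambda>x. 0)" by (intro \<rho>_cong_AE) auto
      then show "\<rho> (\<lambda>x. ennreal (cmod (f x))) = 0" by simp
    qed (intro \<rho>_eq_0_imp_AE; simp)
    finally show ?thesis by simp
  qed
  show "f \<in> carrier \<and> fnorm f \<le> fnorm g" if "g \<in> carrier" "f \<in> borel_measurable half_line"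
    "AE x in half_line. cmod (f x) \<le> cmod (g x)" using that carrier_ideal by blast
  show "indicator A \<in> carrier" if A: "A \<in> sets half_line" "emeasure half_line A < \<infinity>"
  proof -
    have "(\<lambda>x. ennreal (cmod (indicator A x))) = indicator A" by (auto simp: indicator_def)
    then show ?thesis using \<rho>_indicator[OF A] A(1) by (simp add: carrier_def)
  qed
  show "\<exists>C. \<forall>f\<in>carrier. (\<integral>\<^sup>+ x\<in>A. ennreal (cmod (f x)) \<partial>half_line) \<le> ennreal (C * fnorm f)"
    if A: "A \<in> sets half_line" "emeasure half_line A < \<infinity>"
  proof -
    obtain C where C: "\<And>u. u \<in> borel_measurable half_line \<Longrightarrow> (\<integral>\<^sup>+ x\<in>A. u x \<partial>half_line) \<le> ennreal C * \<rho> u"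
      using \<rho>_locally_integrable[OF A] by auto
    show ?thesis
    proof (intro exI ballI)
      fix f assume f: "f \<in> carrier"
      then have [measurable]: "f \<in> borel_measurable half_line" by (simp add: carrier_def)
      have "(\<integral>\<^sup>+ x\<in>A. ennreal (cmod (f x)) \<partial>half_line) \<le> ennreal C * ennreal (fnorm f)"
        using C[of "\<lambda>x. ennreal (cmod (f x))"] f by (simp add: ennreal_fnorm)
      also have "\<dots> \<le> ennreal (max 0 C) * ennreal (fnorm f)"
        by (intro mult_right_mono ennreal_leI) auto
      also have "\<dots> = ennreal (max 0 C * fnorm f)"
        by (subst ennreal_mult) (auto simp: fnorm_def)
      finally show "(\<integral>\<^sup>+ x\<in>A. ennreal (cmod (f x)) \<partial>half_line) \<le> ennreal (max 0 C * fnorm f)" .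
    qed
  qed
  show "g \<in> carrier \<and> fnorm g = fnorm f" if "f \<in> carrier" "g \<in> borel_measurable half_line" "equimeasurable f g"
  proof -
    have "\<rho> (\<lambda>x. ennreal (cmod (f x))) = \<rho> (\<lambda>x. ennreal (cmod (g x)))"
      using that by (intro \<rho>_equidistributed) (auto simp: carrier_def equimeasurable_def)
    then show ?thesis using that by (auto simp: carrier_def fnorm_def)
  qed
next
  fix s :: "nat \<Rightarrow> real \<Rightarrow> complex" and f B
  show "f \<in> carrier \<and> (\<lambda>n. fnorm (s n)) \<longlonglongrightarrow> fnorm f"
    if "\<And>n. s n \<in> carrier" "f \<in> borel_measurable half_line"
      "\<And>n. AE x in half_line. cmod (s n x) \<le> cmod (s (Suc n) x)"
      "AE x in half_line. (\<lambda>n. cmod (s n x)) \<longlonglongrightarrow> cmod (f x)" "\<And>n. fnorm (s n) \<le> B"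
    using that carrier_fatou by blast
next
  fix s :: "nat \<Rightarrow> real \<Rightarrow> complex"
  show "\<exists>f\<in>carrier. (\<lambda>n. fnorm (\<lambda>x. s n x - f x)) \<longlonglongrightarrow> 0"
    if "\<And>n. s n \<in> carrier" 
      "\<And>e. e > 0 \<Longrightarrow> \<exists>K. \<forall>m\<ge>K. \<forall>n\<ge>K. fnorm (\<lambda>x. s m x - s n x) < e"
    using that by (rule carrier_complete)
qed

end

section \<open>The block norm\<close>

definition node :: "nat \<Rightarrow> real" where
  "node k = 2 ^ (k\<^sup>2)"

definition block :: "nat \<Rightarrow> nat" where
  "block k = fst (prod_decode k)"

lemma node_pos [simp]: "node k > 0" and node_nonneg [simp]: "node k \<ge> 0"
  by (simp_all add: node_def)

lemma node_nonzero [simp]: "node k \<noteq> 0"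
  using node_pos[of k] by linarith

lemma infinite_block: "infinite {k. block k = l}"
proof -
  have "inj (\<lambda>m. prod_encode (l, m))" by (auto simp: inj_def)
  then have "infinite (range (\<lambda>m. prod_encode (l, m)))" by (simp add: finite_image_iff)
  moreover have "range (\<lambda>m. prod_encode (l, m)) \<subseteq> {k. block k = l}" by (auto simp: block_def)
  ultimately show ?thesis by (meson finite_subset)
qed

lemma node_le: "2 ^ k \<le> node k"
  unfolding node_def by (intro power_increasing) (auto simp: power2_eq_square)

lemma node_separation:
  assumes "k < i"
  shows "node k * 2 ^ (k + i) \<le> node i"
proof -
  have "k * (k + 1) \<le> (i - 1) * i" using assms by (intro mult_mono) auto
  moreover have "(i - 1) * i + i = i * i" using assms by (cases i) auto
  ultimately have "k\<^sup>2 + (k + i) \<le> i\<^sup>2" by (simp add: power2_eq_square)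
  then show ?thesis unfolding node_def power_add[symmetric] by (intro power_increasing) auto
qed

lemma node_interaction:
  assumes "k \<noteq> i"
  shows "inverse (node k) * (inverse (node i) * min ((node k)\<^sup>2) ((node i)\<^sup>2)) \<le> (1/2) ^ k * (1/2) ^ i"
proof -
  have *: "inverse (node k) * (inverse (node i) * min ((node k)\<^sup>2) ((node i)\<^sup>2)) \<le> (1/2) ^ k * (1/2) ^ i"
    if "k < i" for k i
  proof -
    have "inverse (node k) * (inverse (node i) * min ((node k)\<^sup>2) ((node i)\<^sup>2))
        \<le> inverse (node k) * (inverse (node i) * (node k)\<^sup>2)"
      by (intro mult_left_mono) auto
    also have "\<dots> = node k / node i" by (simp add: field_simps power2_eq_square)
    also have "\<dots> \<le> 1 / 2 ^ (k + i)" using node_separation[OF that] by (simp add: field_simps)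
    finally show ?thesis by (simp add: power_add power_one_over)
  qed
  show ?thesis
    using *[of k i] *[of i k] assms by (cases "k < i") (auto simp: min.commute mult_ac)
qed

definition block_sum :: "nat \<Rightarrow> (real \<Rightarrow> ennreal) \<Rightarrow> ennreal" where
  "block_sum l u = (\<Sum>k. if block k = l
      then ennreal (inverse (node k)) * K_functional half_line ((node k)\<^sup>2) u else 0)"

definition block_norm :: "(real \<Rightarrow> ennreal) \<Rightarrow> ennreal" where
  "block_norm u = (SUP l. block_sum l u)"

lemma block_sum_le_block_norm: "block_sum l u \<le> block_norm u"
  unfolding block_norm_def by (rule SUP_upper) simp

lemma sum_le_block_norm:
  assumes "finite S" "\<And>k. k \<in> S \<Longrightarrow> block k = l"
  shows "(\<Sum>k\<in>S. ennreal (inverse (node k)) * K_functional half_line ((node k)\<^sup>2) u) \<le> block_norm u"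
proof -
  have "(\<Sum>k\<in>S. ennreal (inverse (node k)) * K_functional half_line ((node k)\<^sup>2) u)
    = (\<Sum>k\<in>S. if block k = l then ennreal (inverse (node k)) * K_functional half_line ((node k)\<^sup>2) u else 0)"
    using assms by (intro sum.cong) auto
  also have "\<dots> \<le> block_sum l u"
    unfolding block_sum_def by (intro sum_le_suminf) (auto simp: assms)
  finally show ?thesis using block_sum_le_block_norm[of l u] by (rule order_trans)
qed

interpretation block_norm: ri_function_norm block_norm
proof
  fix u v :: "real \<Rightarrow> ennreal" and c :: real
  assume [measurable]: "u \<in> borel_measurable half_line"
  show "block_norm u \<le> block_norm v" if "AE x in half_line. u x \<le> v x"
    unfolding block_norm_def block_sum_def
    by (intro SUP_mono' suminf_le) (auto intro!: mult_left_mono K_functional_mono that)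
  show "block_norm (\<lambda>x. ennreal c * u x) = ennreal c * block_norm u" if "c \<ge> 0"
  proof -
    have "block_sum l (\<lambda>x. ennreal c * u x) = ennreal c * block_sum l u" for l
      unfolding block_sum_def ennreal_suminf_cmult[symmetric]
      using that by (intro suminf_cong) (auto simp: K_functional_scale mult_ac)
    then show ?thesis by (simp add: block_norm_def SUP_mult_left_ennreal)
  qed
  show "block_norm (\<lambda>x. u x + v x) \<le> block_norm u + block_norm v"
    if [measurable]: "v \<in> borel_measurable half_line"
  proof -
    have "block_sum l (\<lambda>x. u x + v x) \<le> block_norm u + block_norm v" for l
    proof -
      have "block_sum l (\<lambda>x. u x + v x) \<le> block_sum l u + block_sum l v"
        unfolding block_sum_def
        by (subst suminf_add, simp, simp, intro suminf_le)
           (auto simp: distrib_left[symmetric] intro!: mult_left_mono K_functional_add)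
      also have "\<dots> \<le> block_norm u + block_norm v"
        by (intro add_mono block_sum_le_block_norm)
      finally show ?thesis .
    qed
    then show ?thesis unfolding block_norm_def[of "\<lambda>x. u x + v x"] by (intro SUP_least)
  qed
next
  fix w :: "nat \<Rightarrow> real \<Rightarrow> ennreal"
  assume [measurable]: "\<And>n. w n \<in> borel_measurable half_line" and inc: "incseq w"
  have le: "AE x in half_line. w m x \<le> w n x" if "m \<le> n" for m n
    using inc that by (auto simp: incseq_def le_fun_def)
  have "block_sum l (\<lambda>x. SUP n. w n x) \<le> (SUP n. block_norm (w n))" for l
  proof -
    have "block_sum l (\<lambda>x. SUP n. w n x) \<le> (\<Sum>k. SUP n. if block k = l
        then ennreal (inverse (node k)) * K_functional half_line ((node k)\<^sup>2) (w n) else 0)"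
      unfolding block_sum_def
    proof (intro suminf_le)
      fix k
      show "(if block k = l then ennreal (inverse (node k)) * K_functional half_line ((node k)\<^sup>2) (\<lambda>x. SUP n. w n x) else 0)
        \<le> (SUP n. if block k = l then ennreal (inverse (node k)) * K_functional half_line ((node k)\<^sup>2) (w n) else 0)"
        using inc by (auto simp: SUP_mult_left_ennreal[symmetric] intro!: mult_left_mono K_functional_monotone_convergence)
    qed auto
    also have "\<dots> = (SUP n. block_sum l (w n))"
      unfolding block_sum_def
      by (rule ennreal_suminf_SUP_eq) (auto simp: incseq_def intro!: mult_left_mono K_functional_mono le)
    also have "\<dots> \<le> (SUP n. block_norm (w n))"
      by (intro SUP_mono' block_sum_le_block_norm)
    finally show ?thesis .
  qed
  then show "block_norm (\<lambda>x. SUP n. w n x) \<le> (SUP n. block_norm (w n))"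
    unfolding block_norm_def[of "\<lambda>x. SUP n. w n x"] by (intro SUP_least)
next
  fix A assume A: "A \<in> sets half_line" and fin: "emeasure half_line A < \<infinity>"
  have "block_sum l (indicator A) \<le> ennreal 2 * emeasure half_line A" for l
  proof -
    have "block_sum l (indicator A) \<le> (\<Sum>k. ennreal ((1/2) ^ k) * emeasure half_line A)"
      unfolding block_sum_def
    proof (intro suminf_le)
      fix k
      have "inverse (node k) \<le> inverse (2 ^ k)" using node_le[of k] by (intro le_imp_inverse_le) auto
      then have "ennreal (inverse (node k)) * K_functional half_line ((node k)\<^sup>2) (indicator A)
        \<le> ennreal ((1/2) ^ k) * emeasure half_line A"
        using K_functional_indicator_le[OF A, of "(node k)\<^sup>2"]
        by (intro mult_mono ennreal_leI) (auto simp: power_one_over inverse_eq_divide)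
      then show "(if block k = l then ennreal (inverse (node k)) * K_functional half_line ((node k)\<^sup>2) (indicator A) else 0)
        \<le> ennreal ((1/2) ^ k) * emeasure half_line A" by auto
    qed auto
    also have "\<dots> = ennreal 2 * emeasure half_line A"
      using geometric_sums[of "1/2 :: real"]
      by (subst ennreal_suminf_multc, subst suminf_ennreal_eq[where x = 2]) auto
    finally show ?thesis .
  qed
  then have "block_norm (indicator A) \<le> ennreal 2 * emeasure half_line A"
    unfolding block_norm_def by (intro SUP_least)
  also have "\<dots> < \<infinity>" using fin by (simp add: ennreal_mult_less_top)
  finally show "block_norm (indicator A) < \<infinity>" .
  define k where "k = prod_encode (0, 0)"
  obtain m where m: "m \<ge> 0" "emeasure half_line A = ennreal m"
    using fin by (cases "emeasure half_line A") auto
  let ?C = "max 1 (m / (node k)\<^sup>2)"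
  have "(\<integral>\<^sup>+ x\<in>A. u x \<partial>half_line) \<le> ennreal (?C * node k) * block_norm u"
    if [measurable]: "u \<in> borel_measurable half_line" for u
  proof -
    have "(\<integral>\<^sup>+ x\<in>A. u x \<partial>half_line) \<le> ennreal ?C * K_functional half_line ((node k)\<^sup>2) u"
      using A m by (intro set_nn_integral_le_K_functional) auto
    also have "\<dots> = ennreal (?C * node k) * (ennreal (inverse (node k)) * K_functional half_line ((node k)\<^sup>2) u)"
      by (simp add: mult.assoc[symmetric] ennreal_mult[symmetric] del: ennreal_mult'' ennreal_mult')
        (simp add: mult.assoc)
    also have "\<dots> \<le> ennreal (?C * node k) * block_norm u"
      using sum_le_block_norm[of "{k}" 0 u] by (intro mult_left_mono) (auto simp: k_def block_def)
    finally show ?thesis .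
  qed
  then show "\<exists>C. \<forall>u\<in>borel_measurable half_line. (\<integral>\<^sup>+ x\<in>A. u x \<partial>half_line) \<le> ennreal C * block_norm u"
    by blast
next
  fix f g :: "real \<Rightarrow> real"
  assume "f \<in> borel_measurable half_line" "g \<in> borel_measurable half_line"
    "\<And>t. t \<ge> 0 \<Longrightarrow> emeasure half_line {x \<in> space half_line. f x > t}
          = emeasure half_line {x \<in> space half_line. g x > t}"
  then show "block_norm (\<lambda>x. ennreal (f x)) = block_norm (\<lambda>x. ennreal (g x))"
    unfolding block_norm_def block_sum_def
    by (subst K_functional_equidistributed[OF sigma_finite_half_line, of f g]) auto
qed

definition stairs :: "real \<Rightarrow> nat set \<Rightarrow> real \<Rightarrow> complex" where
  "stairs n S x = (\<Sum>i\<in>S. complex_of_real (inverse (n * node i)) * indicator {0..(node i)\<^sup>2} x)"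

lemma cmod_stairs:
  assumes "n \<ge> 0"
  shows "cmod (stairs n S x) = (\<Sum>i\<in>S. inverse (n * node i) * indicator {0..(node i)\<^sup>2} x)"
proof -
  have "stairs n S x = complex_of_real (\<Sum>i\<in>S. inverse (n * node i) * indicator {0..(node i)\<^sup>2} x)"
    unfolding stairs_def of_real_sum by (intro sum.cong) (auto simp: indicator_def)
  moreover have "(\<Sum>i\<in>S. inverse (n * node i) * indicator {0..(node i)\<^sup>2} x) \<ge> 0"
    using assms by (intro sum_nonneg) auto
  ultimately show ?thesis by (simp only: norm_of_real abs_of_nonneg)
qed

lemma ennreal_cmod_stairs:
  assumes "n \<ge> 0"
  shows "ennreal (cmod (stairs n S x))
    = (\<Sum>i\<in>S. ennreal (inverse (n * node i)) * indicator {0..(node i)\<^sup>2} x)"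
proof -
  have "ennreal (inverse (n * node i) * indicator {0..(node i)\<^sup>2} x)
      = ennreal (inverse (n * node i)) * indicator {0..(node i)\<^sup>2} x" for i
    by (simp add: indicator_def)
  then show ?thesis
    unfolding cmod_stairs[OF assms] using assms by (subst sum_ennreal[symmetric]) auto
qed

lemma simple_fun_stairs:
  assumes "finite S"
  shows "simple_fun (stairs n S)"
proof -
  obtain h where h: "bij_betw h {..<card S} S"
    using ex_bij_betw_nat_finite[OF assms] by (auto simp: atLeast0LessThan)
  have "stairs n S x = (\<Sum>i<card S. complex_of_real (inverse (n * node (h i))) * indicator {0..(node (h i))\<^sup>2} x)" for x
    unfolding stairs_def by (rule sum.reindex_bij_betw[OF h, symmetric])
  then show ?thesis
    unfolding simple_fun_def
    by (intro exI[of _ "card S"] exI[of _ "\<lambda>i. complex_of_real (inverse (n * node (h i)))"]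
        exI[of _ "\<lambda>i. {0..(node (h i))\<^sup>2}"]) (auto simp: emeasure_half_line_Icc)
qed

lemma stairs_carrier:
  assumes "finite S"
  shows "stairs n S \<in> block_norm.carrier"
  using assms
proof (induction S rule: finite_induct)
  case empty
  then show ?case by (simp add: stairs_def block_norm.carrier_def)
next
  case (insert i S)
  have "(indicator {0..(node i)\<^sup>2} :: real \<Rightarrow> complex) \<in> block_norm.carrier"
    by (rule ri_banach_space.indicator[OF block_norm.ri_banach_space_carrier])
      (auto simp: emeasure_half_line_Icc)
  then have "(\<lambda>x. complex_of_real (inverse (n * node i)) * indicator {0..(node i)\<^sup>2} x) \<in> block_norm.carrier"
    by (rule block_norm.carrier_scale)
  from block_norm.carrier_add(1)[OF this insert.IH] show ?case
    unfolding stairs_def[abs_def] sum.insert[OF insert.hyps] .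
qed

lemma block_norm_stairs_ge:
  assumes S: "finite S" "S \<noteq> {}" "\<And>k. k \<in> S \<Longrightarrow> block k = l"
  shows "block_norm.fnorm (stairs (card S) S) \<ge> 1"
proof -
  let ?n = "real (card S)" and ?u = "\<lambda>x. ennreal (cmod (stairs (card S) S x))"
  have n: "?n > 0" using S by (simp add: card_gt_0_iff)
  have "1 = (\<Sum>k\<in>S. ennreal (inverse ?n))"
    using n by (simp add: ennreal_of_nat_eq_real_of_nat ennreal_mult[symmetric])
  also have "\<dots> \<le> (\<Sum>k\<in>S. ennreal (inverse (node k)) * K_functional half_line ((node k)\<^sup>2) ?u)"
  proof (intro sum_mono)
    fix k assume k: "k \<in> S"
    have "ennreal (inverse ?n) = ennreal (inverse (node k)) * ennreal ((node k)\<^sup>2 * inverse (?n * node k))"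
      by (simp add: ennreal_mult[symmetric] power2_eq_square del: ennreal_mult'' ennreal_mult')
    also have "ennreal ((node k)\<^sup>2 * inverse (?n * node k)) \<le> K_functional half_line ((node k)\<^sup>2)
        (\<lambda>x. ennreal (inverse (?n * node k)) * indicator {0..(node k)\<^sup>2} x)"
      by (intro K_functional_indicator_ge) (auto simp: emeasure_half_line_Icc)
    also have "\<dots> \<le> K_functional half_line ((node k)\<^sup>2) ?u"
      unfolding ennreal_cmod_stairs[OF of_nat_0_le_iff]
      using S k by (intro K_functional_mono AE_I2 member_le_sum) auto
    finally show "ennreal (inverse ?n) \<le> ennreal (inverse (node k)) * K_functional half_line ((node k)\<^sup>2) ?u"
      by (simp add: mult_left_mono)
  qed
  also have "\<dots> \<le> block_norm ?u" using S by (intro sum_le_block_norm)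
  also have "\<dots> = ennreal (block_norm.fnorm (stairs (card S) S))"
    using S by (intro block_norm.ennreal_fnorm[symmetric] stairs_carrier)
  finally show ?thesis by (simp add: flip: ennreal_1)
qed

lemma block_norm_stairs_le:
  assumes S: "finite S" "inj_on block S" and n: "n > 0"
  shows "block_norm.fnorm (stairs n S) \<le> 5 / n"
proof -
  let ?u = "\<lambda>x. ennreal (cmod (stairs n S x))"
  have "block_sum l ?u \<le> ennreal (5 / n)" for l
  proof -
    let ?t = "\<lambda>i k. inverse n * ((if k = i then of_bool (block i = l) else 0) + (1/2) ^ k * (1/2) ^ i)"
    have "block_sum l ?u \<le> (\<Sum>k. \<Sum>i\<in>S. ennreal (?t i k))"
      unfolding block_sum_def
    proof (intro suminf_le)
      fix k
      have "ennreal (inverse (node k)) * K_functional half_line ((node k)\<^sup>2) ?u \<le> (\<Sum>i\<in>S. ennreal (?t i k))"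
        if k: "block k = l"
      proof -
        have "ennreal (inverse (node k)) * K_functional half_line ((node k)\<^sup>2) ?u
            \<le> ennreal (inverse (node k)) * (\<Sum>i\<in>S. K_functional half_line ((node k)\<^sup>2)
                (\<lambda>x. ennreal (inverse (n * node i)) * indicator {0..(node i)\<^sup>2} x))"
          unfolding ennreal_cmod_stairs[OF less_imp_le[OF n]]
          using S by (intro mult_left_mono K_functional_sum) auto
        also have "\<dots> = (\<Sum>i\<in>S. ennreal (inverse (node k)) * (ennreal (inverse (n * node i)) *
            K_functional half_line ((node k)\<^sup>2) (indicator {0..(node i)\<^sup>2})))"
          using n by (simp add: sum_distrib_left K_functional_scale)
        also have "\<dots> \<le> (\<Sum>i\<in>S. ennreal (?t i k))"
        proof (intro sum_mono)
          fix i assume i: "i \<in> S"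
          have "ennreal (inverse (node k)) * (ennreal (inverse (n * node i)) *
              K_functional half_line ((node k)\<^sup>2) (indicator {0..(node i)\<^sup>2}))
            \<le> ennreal (inverse (node k)) * (ennreal (inverse (n * node i)) *
              min (ennreal ((node k)\<^sup>2)) (ennreal ((node i)\<^sup>2)))"
            using K_functional_indicator_le[of "{0..(node i)\<^sup>2}" half_line "(node k)\<^sup>2"]
            by (intro mult_left_mono) (auto simp: emeasure_half_line_Icc)
          also have "\<dots> = ennreal (inverse n * (inverse (node k) * (inverse (node i) * min ((node k)\<^sup>2) ((node i)\<^sup>2))))"
            using n by (simp add: ennreal_mult[symmetric] min_def mult_ac del: ennreal_mult'' ennreal_mult')
          also have "\<dots> \<le> ennreal (?t i k)"
          proof (intro ennreal_leI mult_left_mono)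
            show "inverse (node k) * (inverse (node i) * min ((node k)\<^sup>2) ((node i)\<^sup>2))
              \<le> (if k = i then of_bool (block i = l) else 0) + (1/2) ^ k * (1/2) ^ i"
            proof (cases "k = i")
              case False
              then show ?thesis using node_interaction[of k i] by simp
            next
              case True
              have "inverse (node i) * (inverse (node i) * (node i)\<^sup>2) = 1"
                by (simp add: power2_eq_square field_simps)
              then show ?thesis using k True by simp
            qed
          qed (use n in auto)
          finally show "ennreal (inverse (node k)) * (ennreal (inverse (n * node i)) *
              K_functional half_line ((node k)\<^sup>2) (indicator {0..(node i)\<^sup>2})) \<le> ennreal (?t i k)" .
        qed
        finally show ?thesis .
      qed
      then show "(if block k = l then ennreal (inverse (node k)) * K_functional half_line ((node k)\<^sup>2) ?u else 0)
        \<le> (\<Sum>i\<in>S. ennreal (?t i k))" by auto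
    qed auto
    also have "\<dots> = (\<Sum>i\<in>S. \<Sum>k. ennreal (?t i k))"
      by (rule suminf_sum) simp
    also have "\<dots> = (\<Sum>i\<in>S. ennreal (inverse n * (of_bool (block i = l) + 2 * (1/2) ^ i)))"
    proof (intro sum.cong refl suminf_ennreal_eq)
      fix i
      have "(\<lambda>k. (1/2 :: real) ^ k) sums 2" using geometric_sums[of "1/2 :: real"] by simp
      from sums_mult2[OF this, of "(1/2) ^ i"]
      show "?t i sums (inverse n * (of_bool (block i = l) + 2 * (1/2) ^ i))"
        using sums_single[of i "\<lambda>k. of_bool (block i = l) :: real"]
        by (intro sums_mult sums_add) auto
    qed (use n in auto)
    also have "\<dots> = ennreal (inverse n * ((\<Sum>i\<in>S. of_bool (block i = l)) + 2 * (\<Sum>i\<in>S. (1/2) ^ i)))"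
      using n by (subst sum_ennreal) (auto simp: sum_distrib_left sum.distrib distrib_left)
    also have "\<dots> \<le> ennreal (inverse n * (1 + 2 * 2))"
    proof (intro ennreal_leI mult_left_mono add_mono)
      have "card {i \<in> S. block i = l} \<le> 1"
        using S by (auto simp: card_le_Suc0_iff_eq inj_on_def)
      then show "(\<Sum>i\<in>S. of_bool (block i = l) :: real) \<le> 1"
        using S by (simp add: of_bool_def sum.If_cases Int_def)
      have "(\<Sum>i\<in>S. (1/2 :: real) ^ i) \<le> (\<Sum>i. (1/2) ^ i)"
        using S by (intro sum_le_suminf) auto
      then show "(\<Sum>i\<in>S. (1/2 :: real) ^ i) \<le> 2"
        by (simp add: suminf_geometric)
    qed (use n in auto)
    finally show ?thesis using n by (simp add: field_simps)
  qed
  then have "block_norm ?u \<le> ennreal (5 / n)" unfolding block_norm_def by (intro SUP_least)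
  then show ?thesis unfolding block_norm.fnorm_def using n by (intro enn2real_leI) auto
qed

section \<open>The modular of a staircase\<close>

lemma phi_functionD:
  assumes "phi_function G"
  shows "strict_mono_on {0..} G" "continuous_on {0..} G" "G 0 = 0" "filterlim G at_top at_top"
  using assms by (auto simp only: phi_function_def)

lemma phi_function_pos: "phi_function G \<Longrightarrow> t > 0 \<Longrightarrow> G t > 0"
  using strict_mono_onD[OF phi_functionD(1), of G 0 t] phi_functionD(3)[of G] by simp

lemma phi_function_mono: "phi_function G \<Longrightarrow> 0 \<le> s \<Longrightarrow> s \<le> t \<Longrightarrow> G s \<le> G t"
  using strict_mono_on_leD[OF phi_functionD(1), of G s t] by simp

lemma phi_function_nonneg: "phi_function G \<Longrightarrow> t \<ge> 0 \<Longrightarrow> G t \<ge> 0"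
  using phi_function_mono[of G 0 t] phi_functionD(3)[of G] by simp

lemma tilde_strict_mono:
  assumes "phi_function G"
  shows "strict_mono_on {0..} (tilde G)"
proof (rule strict_mono_onI)
  fix s t :: real assume st: "s \<in> {0..}" "t \<in> {0..}" "s < t"
  show "tilde G s < tilde G t"
  proof (cases "s = 0")
    case True
    then show ?thesis using st phi_function_pos[OF assms, of "1/t"] by (simp add: tilde_def)
  next
    case False
    then have "G (1/t) < G (1/s)"
      using assms st unfolding phi_function_def
      by (auto intro!: strict_mono_onD[of "{0..}" G] simp: field_simps)
    then show ?thesis
      using False st phi_function_pos[OF assms, of "1/t"] by (auto simp: tilde_def field_simps)
  qed
qed

lemma tilde_bij:
  assumes "phi_function G"
  shows "bij_betw (tilde G) {0..} {0..}"
proof (rule bij_betw_imageI)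
  show "inj_on (tilde G) {0..}"
    using tilde_strict_mono[OF assms] by (rule strict_mono_on_imp_inj_on)
  show "tilde G ` {0..} = {0..}"
  proof safe
    fix t :: real assume "0 \<le> t"
    then show "tilde G t \<ge> 0"
      using phi_function_nonneg[OF assms, of "1/t"] by (simp add: tilde_def)
  next
    fix y :: real assume y: "0 \<le> y"
    show "y \<in> tilde G ` {0..}"
    proof (cases "y = 0")
      case True
      then show ?thesis by (auto simp: tilde_def intro!: image_eqI[of _ _ 0])
    next
      case False
      then have y: "y > 0" using y by simp
      have "eventually (\<lambda>t. G t \<ge> 1/y \<and> t \<ge> 0) at_top"
        using assms eventually_ge_at_top[of "0::real"] unfolding phi_function_def filterlim_at_top
        by (auto intro: eventually_conj)
      then obtain T where T: "G T \<ge> 1/y" "T \<ge> 0" by (auto dest!: eventually_happens)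
      obtain t where t: "0 \<le> t" "t \<le> T" "G t = 1/y"
        using IVT'[of G 0 "1/y" T] assms T y continuous_on_subset[of "{0..}" G "{0..T}"]
        unfolding phi_function_def by auto
      have "t \<noteq> 0" using t y assms by (auto simp: phi_function_def)
      then show ?thesis
        using t y by (intro image_eqI[of _ _ "1/t"]) (auto simp: tilde_def)
    qed
  qed
qed

text \<open>
  \<open>transfer F G\<close> is the change of variables in the Orlicz--Lorentz functional, and \<open>transfer G F\<close> is its
  inverse.
\<close>

definition transfer :: "(real \<Rightarrow> real) \<Rightarrow> (real \<Rightarrow> real) \<Rightarrow> real \<Rightarrow> real" where
  "transfer F G = tilde F \<circ> the_inv_into {0..} (tilde G)"

context
  fixes F G :: "real \<Rightarrow> real"
  assumes F: "phi_function F" and G: "phi_function G"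
begin

lemma transfer_le_iff:
  assumes "x \<ge> 0" "w \<ge> 0"
  shows "transfer F G x \<le> w \<longleftrightarrow> x \<le> transfer G F w"
proof -
  let ?s = "the_inv_into {0..} (tilde G) x" and ?t = "the_inv_into {0..} (tilde F) w"
  have s: "?s \<in> {0..}" "tilde G ?s = x" and t: "?t \<in> {0..}" "tilde F ?t = w"
    using assms bij_betw_apply[OF bij_betw_the_inv_into[OF tilde_bij[OF G]], of x]
      bij_betw_apply[OF bij_betw_the_inv_into[OF tilde_bij[OF F]], of w]
      f_the_inv_into_f_bij_betw[OF tilde_bij[OF G], of x]
      f_the_inv_into_f_bij_betw[OF tilde_bij[OF F], of w] by simp_all
  have "transfer F G x \<le> w \<longleftrightarrow> tilde F ?s \<le> tilde F ?t" using t by (simp add: transfer_def)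
  also have "\<dots> \<longleftrightarrow> ?s \<le> ?t" by (rule strict_mono_on_less_eq[OF tilde_strict_mono[OF F] s(1) t(1)])
  also have "\<dots> \<longleftrightarrow> tilde G ?s \<le> tilde G ?t"
    using strict_mono_on_less_eq[OF tilde_strict_mono[OF G] s(1) t(1)] by simp
  finally show ?thesis using s by (simp add: transfer_def)
qed

lemma transfer_0: "transfer F G 0 = 0"
proof -
  have "tilde G 0 = 0" by (simp add: tilde_def)
  then have "the_inv_into {0..} (tilde G) 0 = 0"
    using the_inv_into_f_f[OF bij_betw_imp_inj_on[OF tilde_bij[OF G]], of 0] by simp
  then show ?thesis by (simp add: transfer_def tilde_def)
qed

lemma transfer_nonneg:
  assumes "x \<ge> 0"
  shows "transfer F G x \<ge> 0"
  using assms bij_betw_apply[OF bij_betw_trans[OF bij_betw_the_inv_into[OF tilde_bij[OF G]] tilde_bij[OF F]], of x]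
  by (simp add: transfer_def)

end

lemma transfer_pos:
  assumes "phi_function F" "phi_function G" "x > 0"
  shows "transfer F G x > 0"
  using transfer_le_iff[OF assms(1,2), of x 0] transfer_0[OF assms(2,1)] assms(3) by simp

lemma extend_top_mono:
  assumes "phi_function G" "y \<le> z"
  shows "extend_top G y \<le> extend_top G z"
proof (cases "z = \<infinity>")
  case False
  then have "y \<noteq> \<infinity>" "enn2real y \<le> enn2real z"
    using assms(2) by (auto simp: top_unique less_top intro!: enn2real_mono)
  then show ?thesis
    using False by (simp add: extend_top_def ennreal_leI phi_function_mono[OF assms(1)])
qed (simp add: extend_top_def)

lemma extend_top_divide:
  assumes "v \<ge> 0" "c > 0"
  shows "extend_top G (ennreal v / ennreal c) = ennreal (G (v / c))"
  using assms by (simp add: divide_ennreal extend_top_def)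

lemma luxemburg_le:
  assumes "c > 0" "(\<integral>\<^sup>+ x. extend_top G (g x / ennreal c) \<partial>half_line) \<le> 1"
  shows "luxemburg G g \<le> ennreal c"
  unfolding luxemburg_def using assms by (intro Inf_lower) auto

lemma luxemburg_less_imp:
  assumes "phi_function G" "luxemburg G g < ennreal c"
  shows "(\<integral>\<^sup>+ x. extend_top G (g x / ennreal c) \<partial>half_line) \<le> 1"
proof -
  obtain d where d: "d > 0" "ennreal d < ennreal c" "(\<integral>\<^sup>+ x. extend_top G (g x / ennreal d) \<partial>half_line) \<le> 1"
    using assms(2) unfolding luxemburg_def Inf_less_iff by auto
  have "(\<integral>\<^sup>+ x. extend_top G (g x / ennreal c) \<partial>half_line) \<le> (\<integral>\<^sup>+ x. extend_top G (g x / ennreal d) \<partial>half_line)"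
  proof (intro nn_integral_mono extend_top_mono assms)
    have "d < c" using d by (simp add: ennreal_less_iff)
    then have "inverse (ennreal c) \<le> inverse (ennreal d)"
      using d(1) by (simp add: inverse_ennreal ennreal_leI)
    then show "g x / ennreal c \<le> g x / ennreal d" for x
      unfolding divide_ennreal_def by (rule mult_left_mono) simp
  qed
  with d show ?thesis by simp
qed

lemma le_rearrangement:
  assumes "t \<ge> 0" "ennreal w \<le> emeasure half_line {y \<in> space half_line. cmod (f y) \<ge> t}"
  shows "ennreal t \<le> rearrangement f w"
  unfolding rearrangement_def using assms by (intro Sup_upper) auto

lemma rearrangement_le:
  assumes "y \<ge> 0" "\<And>t. t > y \<Longrightarrow> emeasure half_line {x \<in> space half_line. cmod (f x) \<ge> t} < ennreal w"
  shows "rearrangement f w \<le> ennreal y"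
  unfolding rearrangement_def using assms
  by (intro Sup_least) (force simp: not_le[symmetric] intro!: ennreal_leI)

lemma le_rearrangement_stairs:
  assumes S: "finite S" "i \<in> S" and n: "n > 0" and w: "w \<le> (node i)\<^sup>2"
  shows "ennreal (inverse (n * node i)) \<le> rearrangement (stairs n S) w"
proof (rule le_rearrangement)
  have "{0..(node i)\<^sup>2} \<subseteq> {y \<in> space half_line. cmod (stairs n S y) \<ge> inverse (n * node i)}"
  proof safe
    fix y assume y: "y \<in> {0..(node i)\<^sup>2}"
    then show "y \<in> space half_line" by simp
    have "inverse (n * node i) * indicator {0..(node i)\<^sup>2} y
        \<le> (\<Sum>i\<in>S. inverse (n * node i) * indicator {0..(node i)\<^sup>2} y)"
      using S n by (intro member_le_sum) auto
    then show "inverse (n * node i) \<le> cmod (stairs n S y)"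
      unfolding cmod_stairs[OF less_imp_le[OF n]] using y by simp
  qed
  moreover have "{y \<in> space half_line. cmod (stairs n S y) \<ge> inverse (n * node i)} \<in> sets half_line"
    unfolding stairs_def[abs_def] by measurable
  ultimately have "emeasure half_line {0..(node i)\<^sup>2}
      \<le> emeasure half_line {y \<in> space half_line. cmod (stairs n S y) \<ge> inverse (n * node i)}"
    by (rule emeasure_mono)
  then show "ennreal w \<le> emeasure half_line {y \<in> space half_line. cmod (stairs n S y) \<ge> inverse (n * node i)}"
    using w by (auto simp: emeasure_half_line_Icc intro: order_trans ennreal_leI)
qed (use n in auto)

lemma sum_inverse_node_le:
  assumes U: "finite U" "\<And>k. k \<in> U \<Longrightarrow> i \<le> k"
  shows "(\<Sum>k\<in>U. inverse (node k)) \<le> 3 * inverse (node i)"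
proof -
  have "(\<Sum>k\<in>U. inverse (node k)) \<le> (\<Sum>k\<in>U. inverse (node i) * ((if k = i then 1 else 0) + (1/2) ^ k))"
  proof (intro sum_mono)
    fix k assume k: "k \<in> U"
    show "inverse (node k) \<le> inverse (node i) * ((if k = i then 1 else 0) + (1/2) ^ k)"
    proof (cases "k = i")
      case False
      then have "i < k" using U(2)[OF k] by simp
      have "node i * 2 ^ k \<le> node i * 2 ^ (i + k)"
        by (intro mult_left_mono power_increasing) auto
      also have "\<dots> \<le> node k" by (rule node_separation[OF \<open>i < k\<close>])
      finally have "inverse (node k) \<le> inverse (node i * 2 ^ k)" by (intro le_imp_inverse_le) auto
      then show ?thesis using False by (simp add: power_one_over inverse_eq_divide)
    qed (simp add: distrib_left)
  qed
  also have "\<dots> = inverse (node i) * ((\<Sum>k\<in>U. if k = i then 1 else 0) + (\<Sum>k\<in>U. (1/2) ^ k))"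
    by (simp only: sum_distrib_left sum.distrib distrib_left)
  also have "\<dots> \<le> inverse (node i) * (1 + 2)"
  proof (intro mult_left_mono add_mono)
    show "(\<Sum>k\<in>U. if k = i then 1 else 0 :: real) \<le> 1" using U by simp
    have "(\<Sum>k\<in>U. (1/2 :: real) ^ k) \<le> (\<Sum>k. (1/2) ^ k)"
      using U by (intro sum_le_suminf) auto
    then show "(\<Sum>k\<in>U. (1/2 :: real) ^ k) \<le> 2"
      by (simp add: suminf_geometric)
  qed auto
  finally show ?thesis by simp
qed

lemma rearrangement_stairs_le:
  assumes S: "finite S" and n: "n > 0" and w: "w > 0"
  shows "rearrangement (stairs n S) w \<le> ennreal (\<Sum>k | k \<in> S \<and> w \<le> (node k)\<^sup>2. inverse (n * node k))"
proof (rule rearrangement_le)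
  let ?U = "{k \<in> S. w \<le> (node k)\<^sup>2}" and ?T = "{k \<in> S. (node k)\<^sup>2 < w}"
  let ?y = "\<Sum>k\<in>?U. inverse (n * node k)"
  show "0 \<le> ?y" using n by (intro sum_nonneg) auto
  define m where "m = Max (insert 0 ((\<lambda>k. (node k)\<^sup>2) ` ?T))"
  have m: "m < w" "m \<ge> 0" "\<And>k. k \<in> ?T \<Longrightarrow> (node k)\<^sup>2 \<le> m"
    using S w unfolding m_def by auto
  fix t assume t: "t > ?y"
  have "{x \<in> space half_line. cmod (stairs n S x) \<ge> t} \<subseteq> {0..m}"
  proof safe
    fix x assume x: "x \<in> space half_line" "cmod (stairs n S x) \<ge> t"
    show "x \<in> {0..m}"
    proof (rule ccontr)
      assume "x \<notin> {0..m}"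
      then have "x > m" using x by simp
      then have "inverse (n * node k) * indicator {0..(node k)\<^sup>2} x = 0" if "k \<in> S - ?U" for k
        using m(3)[of k] that by (auto simp: indicator_def)
      then have "cmod (stairs n S x) = (\<Sum>k\<in>?U. inverse (n * node k) * indicator {0..(node k)\<^sup>2} x)"
        unfolding cmod_stairs[OF less_imp_le[OF n]]
        by (intro sum.mono_neutral_right) (use S in auto)
      also have "\<dots> \<le> ?y" using n by (intro sum_mono) (auto simp: indicator_def)
      finally show False using x t by simp
    qed
  qed
  then have "emeasure half_line {x \<in> space half_line. cmod (stairs n S x) \<ge> t} \<le> ennreal m"
    unfolding emeasure_half_line_Icc[OF m(2), symmetric] by (intro emeasure_mono) auto
  also have "\<dots> < ennreal w" using m by (simp add: ennreal_less_iff)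
  finally show "emeasure half_line {x \<in> space half_line. cmod (stairs n S x) \<ge> t} < ennreal w" .
qed

definition modular :: "(real \<Rightarrow> real) \<Rightarrow> (real \<Rightarrow> real) \<Rightarrow> (real \<Rightarrow> complex) \<Rightarrow> real \<Rightarrow> ennreal" where
  "modular F G f c = (\<integral>\<^sup>+ x. extend_top G (rearrangement f (transfer F G x) / ennreal c) \<partial>half_line)"

lemma orlicz_lorentz_le:
  "c > 0 \<Longrightarrow> modular F G f c \<le> 1 \<Longrightarrow> orlicz_lorentz F G f \<le> ennreal c"
  unfolding modular_def orlicz_lorentz_def
  by (rule luxemburg_le) (auto simp: transfer_def)

lemma orlicz_lorentz_less_imp:
  "phi_function G \<Longrightarrow> orlicz_lorentz F G f < ennreal c \<Longrightarrow> modular F G f c \<le> 1"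
  unfolding modular_def orlicz_lorentz_def
  using luxemburg_less_imp[of G "rearrangement f \<circ> tilde F \<circ> the_inv_into {0..} (tilde G)" c]
  by (auto simp: transfer_def)

lemma modular_stairs_le:
  assumes F: "phi_function F" and G: "phi_function G" and S: "finite S" and n: "n > 0" and c: "c > 0"
  shows "modular F G (stairs n S) c
    \<le> ennreal (\<Sum>i\<in>S. G (3 * inverse (n * node i) / c) * transfer G F ((node i)\<^sup>2))"
proof -
  let ?G = "\<lambda>i. G (3 * inverse (n * node i) / c)" and ?h = "\<lambda>i. transfer G F ((node i)\<^sup>2)"
  have G0: "?G i \<ge> 0" for i using n c by (intro phi_function_nonneg[OF G]) auto
  have h0: "?h i \<ge> 0" for i by (intro transfer_nonneg F G) auto
  have "{0::real} \<in> null_sets half_line"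
    by (auto simp: null_sets_def sets_restrict_space_iff emeasure_restrict_space)
  then have "AE x in half_line. x \<noteq> 0" by (rule AE_I') auto
  moreover have "AE x in half_line. x \<ge> 0" by (rule AE_I2) simp
  ultimately have "AE x in half_line. x > 0" by eventually_elim auto
  then have "AE x in half_line. extend_top G (rearrangement (stairs n S) (transfer F G x) / ennreal c)
      \<le> (\<Sum>i\<in>S. ennreal (?G i) * indicator {0..?h i} x)"
  proof eventually_elim
    fix x :: real assume x: "x > 0"
    let ?w = "transfer F G x" let ?U = "{k \<in> S. ?w \<le> (node k)\<^sup>2}"
    have w: "?w > 0" using F G x by (rule transfer_pos)
    let ?y = "\<Sum>k\<in>?U. inverse (n * node k)"
    have y: "?y \<ge> 0" using n by (intro sum_nonneg) auto
    have "extend_top G (rearrangement (stairs n S) ?w / ennreal c) \<le> extend_top G (ennreal ?y / ennreal c)"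
      by (intro extend_top_mono G divide_right_mono_ennreal rearrangement_stairs_le S n w)
    also have "\<dots> = ennreal (G (?y / c))" using y c by (rule extend_top_divide)
    also have "\<dots> \<le> (\<Sum>i\<in>S. ennreal (?G i) * indicator {0..?h i} x)"
    proof (cases "?U = {}")
      case True
      then have "?y = 0" by (simp only: sum.empty)
      then show ?thesis using phi_functionD(3)[OF G] by simp
    next
      case False
      define i where "i = Min ?U"
      have i: "i \<in> ?U" "\<And>k. k \<in> ?U \<Longrightarrow> i \<le> k"
        using S False Min_in[of ?U] unfolding i_def by auto
      have "?y = inverse n * (\<Sum>k\<in>?U. inverse (node k))"
        by (simp add: sum_distrib_left)
      also have "\<dots> \<le> inverse n * (3 * inverse (node i))"
        using S n i by (intro mult_left_mono sum_inverse_node_le) auto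
      finally have "?y \<le> 3 * inverse (n * node i)" by simp
      then have "ennreal (G (?y / c)) \<le> ennreal (?G i)"
        using y c by (intro ennreal_leI phi_function_mono[OF G] divide_right_mono) auto
      also have "\<dots> = ennreal (?G i) * indicator {0..?h i} x"
        using i(1) x transfer_le_iff[OF F G, of x "(node i)\<^sup>2"] by simp
      also have "\<dots> \<le> (\<Sum>i\<in>S. ennreal (?G i) * indicator {0..?h i} x)"
        using S i by (intro member_le_sum) auto
      finally show ?thesis .
    qed
    finally show "extend_top G (rearrangement (stairs n S) ?w / ennreal c)
        \<le> (\<Sum>i\<in>S. ennreal (?G i) * indicator {0..?h i} x)" .
  qed
  then have "modular F G (stairs n S) c \<le> (\<integral>\<^sup>+ x. (\<Sum>i\<in>S. ennreal (?G i) * indicator {0..?h i} x) \<partial>half_line)"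
    unfolding modular_def by (rule nn_integral_mono_AE)
  also have "\<dots> = (\<Sum>i\<in>S. ennreal (?G i) * ennreal (?h i))"
    using h0 by (subst nn_integral_sum) (auto simp: nn_integral_cmult_indicator emeasure_half_line_Icc)
  also have "\<dots> = ennreal (\<Sum>i\<in>S. ?G i * ?h i)"
    using G0 h0 by (subst sum_ennreal[symmetric]) (auto simp: ennreal_mult)
  finally show ?thesis .
qed

lemma le_modular_stairs:
  assumes F: "phi_function F" and G: "phi_function G" and S: "finite S" and n: "n > 0" and c: "c > 0"
    and sep: "\<And>i j. i \<in> S \<Longrightarrow> j \<in> S \<Longrightarrow> i \<noteq> j \<Longrightarrow>
      2 * transfer G F ((node i)\<^sup>2) \<le> transfer G F ((node j)\<^sup>2) \<or>
      2 * transfer G F ((node j)\<^sup>2) \<le> transfer G F ((node i)\<^sup>2)"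
  shows "ennreal (\<Sum>i\<in>S. G (inverse (n * node i) / c) * (transfer G F ((node i)\<^sup>2) / 2))
    \<le> modular F G (stairs n S) c"
proof -
  let ?G = "\<lambda>i. G (inverse (n * node i) / c)" and ?h = "\<lambda>i. transfer G F ((node i)\<^sup>2)"
  \<comment> \<open>By \<open>sep\<close> these intervals are disjoint, and each has half the measure of \<open>{0..?h i}\<close>.\<close>
  let ?E = "\<lambda>i. {?h i / 2<..?h i}"
  have G0: "?G i \<ge> 0" for i using n c by (intro phi_function_nonneg[OF G]) auto
  have h0: "?h i \<ge> 0" for i by (intro transfer_nonneg F G) auto
  have E: "?E i \<in> sets half_line" "emeasure half_line (?E i) = ennreal (?h i / 2)" for i
  proof -
    have sub: "?E i \<subseteq> {0..}" using h0[of i] by auto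
    then show "?E i \<in> sets half_line" by (simp add: sets_restrict_space_iff)
    have "emeasure half_line (?E i) = emeasure lebesgue (?E i)"
      using sub by (intro emeasure_restrict_space) auto
    also have "\<dots> = ennreal (?h i - ?h i / 2)" using h0[of i] by simp
    also have "?h i - ?h i / 2 = ?h i / 2" by simp
    finally show "emeasure half_line (?E i) = ennreal (?h i / 2)" .
  qed
  have le: "(\<Sum>i\<in>S. ennreal (?G i) * indicator (?E i) x)
      \<le> extend_top G (rearrangement (stairs n S) (transfer F G x) / ennreal c)" for x
  proof (cases "\<exists>i\<in>S. x \<in> ?E i")
    case True
    then obtain i where i: "i \<in> S" "x \<in> ?E i" by auto
    have x: "x \<ge> 0" using i(2) h0[of i] by auto
    have "x \<notin> ?E j" if "j \<in> S" "j \<noteq> i" for j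
      using sep[of i j] that i by auto
    then have "(\<Sum>i\<in>S. ennreal (?G i) * indicator (?E i) x) = (\<Sum>j\<in>{i}. ennreal (?G j) * indicator (?E j) x)"
      using S i by (intro sum.mono_neutral_right) auto
    also have "\<dots> = extend_top G (ennreal (inverse (n * node i)) / ennreal c)"
      using i n c by (subst extend_top_divide) auto
    also have "\<dots> \<le> extend_top G (rearrangement (stairs n S) (transfer F G x) / ennreal c)"
      using S i n transfer_le_iff[OF F G x, of "(node i)\<^sup>2"]
      by (intro extend_top_mono G divide_right_mono_ennreal le_rearrangement_stairs) auto
    finally show ?thesis .
  next
    case False
    then have "(\<Sum>i\<in>S. ennreal (?G i) * indicator (?E i) x) = 0" by (intro sum.neutral) auto
    then show ?thesis by simp
  qed
  have "ennreal (\<Sum>i\<in>S. ?G i * (?h i / 2)) = (\<Sum>i\<in>S. ennreal (?G i * (?h i / 2)))"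
    using G0 h0 by (intro sum_ennreal[symmetric] mult_nonneg_nonneg) auto
  also have "\<dots> = (\<Sum>i\<in>S. ennreal (?G i) * ennreal (?h i / 2))"
    using G0 h0 by (intro sum.cong refl ennreal_mult) auto
  also have "\<dots> = (\<integral>\<^sup>+ x. (\<Sum>i\<in>S. ennreal (?G i) * indicator (?E i) x) \<partial>half_line)"
    using E by (subst nn_integral_sum) (auto simp: nn_integral_cmult_indicator)
  also have "\<dots> \<le> modular F G (stairs n S) c"
    unfolding modular_def by (intro nn_integral_mono le)
  finally show ?thesis .
qed

lemma block_norm_not_equivalent:
  assumes F: "phi_function F" and G: "phi_function G" and c: "c > 0"
    and lower: "\<And>f. simple_fun f \<Longrightarrow> ennreal (inverse c * block_norm.fnorm f) \<le> orlicz_lorentz F G f"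
    and upper: "\<And>f. simple_fun f \<Longrightarrow> orlicz_lorentz F G f \<le> ennreal (c * block_norm.fnorm f)"
  shows False
proof -
  let ?h = "\<lambda>i. transfer G F ((node i)\<^sup>2)"
  have h0: "?h i \<ge> 0" for i by (intro transfer_nonneg F G) auto
  obtain n :: nat where n: "30 * c\<^sup>2 < real n" using reals_Archimedean2 by auto
  then have n0: "real n > 0" using c by (meson less_trans mult_pos_pos zero_less_numeral zero_less_power)
  let ?G = "\<lambda>i. G (inverse (n * node i) / inverse (6 * c))"
  have pick: "\<exists>i. (block i = l \<and> ?G i * ?h i > 1 / n) \<and> ?h i \<ge> B" for l B
  proof -
    obtain K :: nat where K: "transfer F G (max 0 B) \<le> real K" using real_arch_simple by blast
    have "finite {k. \<not> ?h k \<ge> B}"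
    proof (rule finite_subset)
      show "{k. \<not> ?h k \<ge> B} \<subseteq> {..K}"
      proof (rule ccontr)
        assume "\<not> {k. \<not> ?h k \<ge> B} \<subseteq> {..K}"
        then obtain k where "k \<in> {k. \<not> ?h k \<ge> B}" "k \<notin> {..K}" by blast
        then have k: "\<not> ?h k \<ge> B" "k > K" by auto
        have "K \<le> 2 ^ k" using k(2) less_exp[of k] by linarith
        then have "real K \<le> 2 ^ k" by (metis of_nat_le_iff of_nat_numeral of_nat_power)
        also have "\<dots> \<le> node k" by (rule node_le)
        also have "\<dots> \<le> (node k)\<^sup>2" by (intro self_le_power) (auto simp: node_def)
        finally have "max 0 B \<le> ?h k" using K transfer_le_iff[OF F G, of "max 0 B" "(node k)\<^sup>2"] by simp
        then show False using k by simp
      qed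
    qed simp
    then have "infinite ({k. block k = l} - {k. \<not> ?h k \<ge> B})" using infinite_block by (rule Diff_infinite_finite)
    then obtain S where S: "S \<subseteq> {k. block k = l} - {k. \<not> ?h k \<ge> B}" "finite S" "card S = n"
      using infinite_arbitrarily_large by metis
    have Sne: "S \<noteq> {}" using S n0 by auto
    have "1 \<le> block_norm.fnorm (stairs n S)"
      using block_norm_stairs_ge[of S l] S Sne by auto
    then have "ennreal (inverse c * 1) \<le> ennreal (inverse c * block_norm.fnorm (stairs n S))"
      using c by (intro ennreal_leI mult_left_mono) auto
    also have "\<dots> \<le> orlicz_lorentz F G (stairs n S)" using S by (intro lower simple_fun_stairs)
    finally have *: "ennreal (inverse c) \<le> orlicz_lorentz F G (stairs n S)" by simp
    have "\<not> modular F G (stairs n S) (inverse (2 * c)) \<le> 1"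
    proof
      assume "modular F G (stairs n S) (inverse (2 * c)) \<le> 1"
      then have "orlicz_lorentz F G (stairs n S) \<le> ennreal (inverse (2 * c))"
        using c by (intro orlicz_lorentz_le) auto
      with * have "ennreal (inverse c) \<le> ennreal (inverse (2 * c))" by (rule order_trans)
      then show False using c by (simp add: ennreal_le_iff)
    qed
    then have "1 < modular F G (stairs n S) (inverse (2 * c))" by simp
    also have "\<dots> \<le> ennreal (\<Sum>i\<in>S. G (3 * inverse (n * node i) / inverse (2 * c)) * ?h i)"
      using S n0 c by (intro modular_stairs_le F G) auto
    also have "(\<Sum>i\<in>S. G (3 * inverse (n * node i) / inverse (2 * c)) * ?h i) = (\<Sum>i\<in>S. ?G i * ?h i)"
      by (simp add: mult_ac)
    finally have gt: "1 < (\<Sum>i\<in>S. ?G i * ?h i)"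
      by (simp flip: ennreal_1 add: ennreal_less_iff)
    have "\<exists>i\<in>S. ?G i * ?h i > 1 / n"
    proof (rule ccontr)
      assume "\<not> (\<exists>i\<in>S. ?G i * ?h i > 1 / n)"
      then have "(\<Sum>i\<in>S. ?G i * ?h i) \<le> (\<Sum>i\<in>S. 1 / n)" by (intro sum_mono) auto
      also have "\<dots> = 1" using S n0 by simp
      finally show False using gt by simp
    qed
    then show ?thesis using S by blast
  qed
  obtain i where i: "\<And>l. block (i l) = l" "\<And>l. ?G (i l) * ?h (i l) > 1 / n"
    "\<And>l. 2 * ?h (i l) \<le> ?h (i (Suc l))"
    using dependent_nat_choice[of "\<lambda>l i. block i = l \<and> ?G i * ?h i > 1 / n" "\<lambda>l i j. 2 * ?h i \<le> ?h j"] pick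
    by metis
  have inj: "inj i" using i(1) by (metis injI)
  have mono: "?h (i l) \<le> ?h (i m)" if "l \<le> m" for l m
    using that
  proof (induction rule: dec_induct)
    case (step m)
    then show ?case using i(3)[of m] h0[of "i m"] by simp
  qed simp
  have dbl: "2 * ?h (i l) \<le> ?h (i m)" if "l < m" for l m
    using i(3)[of l] mono[of "Suc l" m] that by simp
  define S where "S = i ` {..<2 * n}"
  have S: "finite S" "inj_on block S" "card S = 2 * n"
    using i(1) inj by (auto simp: S_def inj_on_def card_image)
  have "orlicz_lorentz F G (stairs n S) \<le> ennreal (c * block_norm.fnorm (stairs n S))"
    using S by (intro upper simple_fun_stairs)
  also have "\<dots> \<le> ennreal (c * (5 / n))"
    using c S n0 by (intro ennreal_leI mult_left_mono block_norm_stairs_le) auto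
  also have "\<dots> < ennreal (inverse (6 * c))"
    using c n n0 by (intro ennreal_lessI) (auto simp: field_simps power2_eq_square)
  finally have le_1: "modular F G (stairs n S) (inverse (6 * c)) \<le> 1"
    by (rule orlicz_lorentz_less_imp[OF G])
  have "ennreal (\<Sum>k\<in>S. ?G k * (?h k / 2)) \<le> modular F G (stairs n S) (inverse (6 * c))"
  proof (rule le_modular_stairs)
    fix k k' assume "k \<in> S" "k' \<in> S" "k \<noteq> k'"
    then obtain l m where "k = i l" "k' = i m" "l \<noteq> m" by (auto simp: S_def)
    then show "2 * ?h k \<le> ?h k' \<or> 2 * ?h k' \<le> ?h k"
      using dbl[of l m] dbl[of m l] by (cases "l < m") auto
  qed (use F G S n0 c in auto)
  also note le_1
  also have "(1 :: ennreal) = ennreal 1" by simp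
  finally have "ennreal (\<Sum>k\<in>S. ?G k * (?h k / 2)) \<le> ennreal 1" .
  then have le: "(\<Sum>k\<in>S. ?G k * (?h k / 2)) \<le> 1" by (subst (asm) ennreal_le_iff) auto
  have "1 = (\<Sum>k\<in>S. 1 / (2 * n))" using S n0 by simp
  also have "\<dots> < (\<Sum>k\<in>S. ?G k * (?h k / 2))"
  proof (rule sum_strict_mono)
    fix k assume "k \<in> S"
    then show "1 / real (2 * n) < ?G k * (?h k / 2)" using i(2) by (auto simp: S_def field_simps)
  qed (use S n0 in auto)
  finally show False using le by simp
qed

theorem theorem6p1:
  "\<exists>X N. ri_banach_space X N \<and>
     (\<forall>F G. phi_function F \<longrightarrow> phi_function G \<longrightarrow>
        \<not> (\<exists>c::real. c > 0 \<and>
             (\<forall>f. simple_fun f \<longrightarrow>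
                ennreal (inverse c * N f) \<le> orlicz_lorentz F G f \<and>
                orlicz_lorentz F G f \<le> ennreal (c * N f))))"
  using block_norm.ri_banach_space_carrier block_norm_not_equivalent by blast

end
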